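(* Let $n$ be even and let $A$ be an $n\times n$ matrix drawn from $\mathrm{GOE}(n)$. Let $A=\sum_{i=1}^n\lambda_iv_iv_i^T$ be its spectral decomposition with $\lambda_1\ge\dots\ge\lambda_n$, and let $$Z=\sum_{i=1}^n\left[(-1)^{\mathbb{1}[i>n/2]}\tfrac{3\pi}{8}\sqrt n-\lambda_i\right]v_iv_i^T.$$ Then for every $k\in[n]$ and every constant $K>0$, $\Pr\left[|Z_{kk}|\ge n^{1/6}\right]=O(n^{-K})$.
   Context: $\mathrm{GOE}(n)$: symmetric random matrix with independent entries (up to symmetry), $A_{ij}\sim\mathrm{N}(0,1)$ for $i<j$ and $A_{ii}\sim\mathrm{N}(0,2)$. The sign $(-1)^{\mathbb{1}[i>n/2]}$ is $+1$ for $i\le n/2$ and $-1$ for $i>n/2$. *)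

theory Defs
  imports "HOL-Probability.Probability"
begin

definition goe_index :: "nat \<Rightarrow> (nat \<times> nat) set" where
  "goe_index n = {(i, j). i \<le> j \<and> j < n}"

text \<open>GOE(n) as the product of the laws of the independent entries:
  off-diagonal N(0,1), diagonal N(0,2) (standard deviation sqrt 2).\<close>
definition GOE :: "nat \<Rightarrow> ((nat \<times> nat) \<Rightarrow> real) measure" where
  "GOE n = PiM (goe_index n)
     (\<lambda>(i, j). density lborel (normal_density 0 (if i = j then sqrt 2 else 1)))"

definition goe_mat :: "((nat \<times> nat) \<Rightarrow> real) \<Rightarrow> nat \<Rightarrow> nat \<Rightarrow> real" where
  "goe_mat \<omega> i j = \<omega> (min i j, max i j)"

definition spectral_decomp ::
  "nat \<Rightarrow> (nat \<Rightarrow> nat \<Rightarrow> real) \<Rightarrow> (nat \<Rightarrow> real) \<Rightarrow> (nat \<Rightarrow> nat \<Rightarrow> real) \<Rightarrow> bool" where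
  "spectral_decomp n A lam v \<longleftrightarrow>
     (\<forall>i j. i \<le> j \<and> j < n \<longrightarrow> lam j \<le> lam i) \<and>
     (\<forall>i<n. \<forall>j<n. (\<Sum>l<n. v i l * v j l) = (if i = j then 1 else 0)) \<and>
     (\<forall>p<n. \<forall>q<n. A p q = (\<Sum>i<n. lam i * v i p * v i q))"

text \<open>Sign (-1)^[i > n/2] for 1-based i, i.e. +1 for 0-based i < n/2.\<close>
definition sgn_half :: "nat \<Rightarrow> nat \<Rightarrow> real" where
  "sgn_half n i = (if i < n div 2 then 1 else -1)"

definition Zmat :: "nat \<Rightarrow> (nat \<Rightarrow> real) \<Rightarrow> (nat \<Rightarrow> nat \<Rightarrow> real) \<Rightarrow> nat \<Rightarrow> nat \<Rightarrow> real" where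
  "Zmat n lam v p q =
     (\<Sum>i<n. (sgn_half n i * (3 * pi / 8) * sqrt (real n) - lam i) * v i p * v i q)"

end

theory Submission
  imports Defs "HOL-Real_Asymp.Real_Asymp"
begin

text \<open>
  Since \<open>Z\<^sub>k\<^sub>k = (3\<pi>/8) \<surd>n \<Sum>\<^sub>i s\<^sub>i v\<^sub>i(k)\<^sup>2 - A\<^sub>k\<^sub>k\<close> with \<open>s\<^sub>i = \<plusminus>1\<close> balanced, and \<open>A\<^sub>k\<^sub>k\<close> has a Gaussian tail,
  it suffices to show that \<open>\<Sum>\<^sub>i s\<^sub>i \<langle>v\<^sub>i, e\<^sub>k\<rangle>\<^sup>2\<close> is small. GOE is invariant under conjugation by plane
  rotations, so the probability that \<open>\<Sum>\<^sub>i s\<^sub>i \<langle>v\<^sub>i, u\<rangle>\<^sup>2\<close> is large is the same for all unit vectors \<open>u\<close>.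
  Average it over \<open>u = \<epsilon>/\<surd>n\<close> with \<open>\<epsilon>\<close> a sign vector and exchange the average with the expectation:
  for a fixed orthonormal basis, a Gaussian linearisation of the squares shows that
  \<open>\<Sum>\<^bsub>i \<in> S\<^esub> \<langle>v\<^sub>i, \<epsilon>\<rangle>\<^sup>2\<close> concentrates around \<open>card S\<close>. The exchange needs the decomposition to be
  essentially unique: almost surely the spectrum is simple, because a multiple eigenvalue forces
  the last row to be orthogonal to an eigenvector of the leading principal minor. Events that
  quantify over decompositions are measurable because they are closed, the eigenvectors ranging
  over a compact set.
\<close>

subsection \<open>Orthonormal families and eigenvectors\<close>

text \<open>The target n^(1/6) against the factor sqrt n asks for a signed sum of order n^(-1/3),
  while its average over sign vectors fluctuates on the scale n^(-1/2). This slack turns the tail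
  exp(-tau^2 n / 32) into exp(-c n^(1/3)), below every power of n. Evenness of n gives both halves
  n/2 eigenvectors, so the mean squares cancel. Sign vectors stand in for the uniform law on the
  sphere: the average is a finite sum and the coordinates stay independent. The obstacle is that
  \<open>lam\<close> and \<open>v\<close> are bound existentially instead of being chosen as
  functions of the matrix. For one matrix, different directions \<open>u\<close> could be bad
  through different decompositions, and a count for a fixed basis would say nothing about their
  number; with a simple spectrum the squared coefficients are functions of the matrix alone. Weak
  inequalities, and orthonormal rather than merely independent witnesses, are chosen so that the
  events are closed.\<close>

definition dotp :: "nat \<Rightarrow> (nat \<Rightarrow> real) \<Rightarrow> (nat \<Rightarrow> real) \<Rightarrow> real" where
  "dotp n x y = (\<Sum>l<n. x l * y l)"

text \<open>The index set is arbitrary because three kinds occur: a full basis, one half of it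
  (concentration), and a hypothetical family of \<open>Suc n\<close> vectors (counting
  eigenvalues).\<close>

definition orthonormal_family :: "nat \<Rightarrow> nat set \<Rightarrow> (nat \<Rightarrow> nat \<Rightarrow> real) \<Rightarrow> bool" where
  "orthonormal_family n S v \<longleftrightarrow>
     (\<forall>i\<in>S. \<forall>j\<in>S. dotp n (v i) (v j) = (if i = j then 1 else 0))"

text \<open>The zero vector is allowed, so the condition is linear and closed; normalisation is
  always stated separately.\<close>

definition eigenvector_of :: "nat \<Rightarrow> (nat \<Rightarrow> nat \<Rightarrow> real) \<Rightarrow> real \<Rightarrow> (nat \<Rightarrow> real) \<Rightarrow> bool" where
  "eigenvector_of n A \<mu> w \<longleftrightarrow> (\<forall>i<n. dotp n (A i) w = \<mu> * w i)"

text \<open>Orthonormality of the two witnesses is a closed condition on a compact set, which linear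
  independence is not.\<close>

definition double_eigenvalue :: "nat \<Rightarrow> (nat \<Rightarrow> nat \<Rightarrow> real) \<Rightarrow> bool" where
  "double_eigenvalue n A \<longleftrightarrow>
     (\<exists>w w' \<mu>. dotp n w w = 1 \<and> dotp n w' w' = 1 \<and> dotp n w w' = 0 \<and>
        eigenvector_of n A \<mu> w \<and> eigenvector_of n A \<mu> w')"

lemma dotp_commute: "dotp n x y = dotp n y x"
  by (simp add: dotp_def mult.commute)

lemma dotp_diff_right: "dotp n x (\<lambda>l. y l - z l) = dotp n x y - dotp n x z"
  by (simp add: dotp_def algebra_simps sum_subtractf)

lemma dotp_scale_right: "dotp n x (\<lambda>l. c * y l) = c * dotp n x y"
  by (simp add: dotp_def algebra_simps sum_distrib_left)

lemma dotp_sum_right: "dotp n x (\<lambda>l. \<Sum>i\<in>S. f i l) = (\<Sum>i\<in>S. dotp n x (f i))"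
  unfolding dotp_def sum_distrib_left by (rule sum.swap)

lemma dotp_diff_left: "dotp n (\<lambda>l. y l - z l) x = dotp n y x - dotp n z x"
  using dotp_diff_right by (simp add: dotp_commute)

lemma dotp_scale_left: "dotp n (\<lambda>l. c * y l) x = c * dotp n y x"
  using dotp_scale_right by (simp add: dotp_commute)

lemma dotp_self_nonneg: "0 \<le> dotp n x x"
  by (simp add: dotp_def sum_nonneg)

lemma dotp_self_eq_0_iff: "dotp n x x = 0 \<longleftrightarrow> (\<forall>l<n. x l = 0)"
  by (auto simp: dotp_def sum_nonneg_eq_0_iff)

lemma dotp_cong:
  assumes "\<And>l. l < n \<Longrightarrow> x l = x' l" "\<And>l. l < n \<Longrightarrow> y l = y' l"
  shows "dotp n x y = dotp n x' y'"
  using assms by (simp add: dotp_def)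

text \<open>Pythagoras: the residual of the projection is orthogonal to the family, so its square
  length is its product with \<open>x\<close>. Nonnegativity gives Bessel; a zero right-hand side
  forces the residual to vanish, which later gives completeness of a basis.\<close>

lemma dotp_orthogonal_residual:
  fixes x :: "nat \<Rightarrow> real"
  assumes "finite S" and on: "orthonormal_family n S v"
  defines "y \<equiv> \<lambda>l. x l - (\<Sum>i\<in>S. dotp n x (v i) * v i l)"
  shows "dotp n y y = dotp n x x - (\<Sum>i\<in>S. (dotp n x (v i))\<^sup>2)"
proof -
  have orth: "dotp n y (v j) = 0" if "j \<in> S" for j
  proof -
    have "dotp n (v j) y = dotp n (v j) x - (\<Sum>i\<in>S. dotp n x (v i) * dotp n (v j) (v i))"
      unfolding y_def dotp_diff_right dotp_sum_right dotp_scale_right by simp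
    also have "(\<Sum>i\<in>S. dotp n x (v i) * dotp n (v j) (v i)) = (\<Sum>i\<in>S. if j = i then dotp n x (v i) else 0)"
      using on that unfolding orthonormal_family_def by (intro sum.cong) auto
    also have "\<dots> = dotp n x (v j)" using assms(1) that by simp
    finally show ?thesis by (simp add: dotp_commute)
  qed
  have "dotp n y y = dotp n y x - (\<Sum>i\<in>S. dotp n x (v i) * dotp n y (v i))"
    by (subst (2) y_def) (simp add: dotp_diff_right dotp_sum_right dotp_scale_right)
  also have "\<dots> = dotp n x y" using orth by (simp add: dotp_commute)
  also have "\<dots> = dotp n x x - (\<Sum>i\<in>S. dotp n x (v i) * dotp n x (v i))"
    unfolding y_def dotp_diff_right dotp_sum_right dotp_scale_right by simp
  finally show ?thesis by (simp add: power2_eq_square)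
qed

lemma bessel_inequality:
  assumes "finite S" "orthonormal_family n S v"
  shows "(\<Sum>i\<in>S. (dotp n x (v i))\<^sup>2) \<le> dotp n x x"
proof -
  have "0 \<le> dotp n x x - (\<Sum>i\<in>S. (dotp n x (v i))\<^sup>2)"
    unfolding dotp_orthogonal_residual[OF assms, symmetric] by (rule dotp_self_nonneg)
  then show ?thesis by simp
qed

lemma dotp_unit_vector:
  assumes "p < n"
  shows "dotp n (\<lambda>l. if l = p then 1 else 0) y = y p"
proof -
  have "dotp n (\<lambda>l. if l = p then 1 else 0) y = (\<Sum>l<n. if l = p then y l else 0)"
    unfolding dotp_def by (intro sum.cong) auto
  then show ?thesis using assms by simp
qed

lemma orthonormal_family_coordinate_sum_le:
  assumes "finite S" "orthonormal_family n S v" "p < n"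
  shows "(\<Sum>i\<in>S. (v i p)\<^sup>2) \<le> 1"
  using bessel_inequality[OF assms(1,2), of "\<lambda>l. if l = p then 1 else 0"] assms(3)
  by (simp add: dotp_unit_vector)

lemma orthonormal_family_total_sum:
  assumes "orthonormal_family n S v"
  shows "(\<Sum>p<n. \<Sum>i\<in>S. (v i p)\<^sup>2) = real (card S)"
proof -
  have "(\<Sum>p<n. \<Sum>i\<in>S. (v i p)\<^sup>2) = (\<Sum>i\<in>S. dotp n (v i) (v i))"
    unfolding dotp_def power2_eq_square by (rule sum.swap)
  also have "\<dots> = (\<Sum>i\<in>S. 1)"
    using assms unfolding orthonormal_family_def by (intro sum.cong) auto
  finally show ?thesis by simp
qed

text \<open>Double counting: the squared entries total \<open>card S\<close>, and each of the
  \<open>n\<close> coordinates contributes at most 1.\<close>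

lemma card_orthonormal_family_le:
  assumes "finite S" "orthonormal_family n S v"
  shows "card S \<le> n"
proof -
  have "real (card S) \<le> (\<Sum>p<n. 1)"
    unfolding orthonormal_family_total_sum[OF assms(2), symmetric]
    using orthonormal_family_coordinate_sum_le[OF assms] by (intro sum_mono) auto
  then show ?thesis by simp
qed

text \<open>Bessel gives that each coordinate sum is at most 1; the total is n, so all are equalities.\<close>

lemma orthonormal_basis_coordinate_sum:
  assumes on: "orthonormal_family n {..<n} v" and "p < n"
  shows "(\<Sum>i<n. (v i p)\<^sup>2) = 1"
proof (rule ccontr)
  assume "(\<Sum>i<n. (v i p)\<^sup>2) \<noteq> 1"
  then have "(\<Sum>i<n. (v i p)\<^sup>2) < 1"
    using orthonormal_family_coordinate_sum_le[OF _ on \<open>p < n\<close>] by simp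
  then have "(\<Sum>p<n. \<Sum>i<n. (v i p)\<^sup>2) < (\<Sum>p<n. 1)"
    using \<open>p < n\<close> by (intro sum_strict_mono_ex1)
      (auto intro!: orthonormal_family_coordinate_sum_le[OF _ on])
  then show False using orthonormal_family_total_sum[OF on] by simp
qed

lemma orthonormal_basis_expansion:
  assumes on: "orthonormal_family n {..<n} v" and "l < n"
  shows "x l = (\<Sum>i<n. dotp n x (v i) * v i l)"
proof -
  \<comment> \<open>The residual of a coordinate vector has square length 1 - 1 = 0. This is the
    completeness relation; the expansion of any \<open>x\<close> follows by linearity.\<close>
  have unit: "(\<Sum>i<n. v i p * v i l) = (if l = p then 1 else 0)" if "p < n" for p
  proof -
    let ?e = "\<lambda>l. if l = p then 1 else 0 :: real"
    let ?y = "\<lambda>l. ?e l - (\<Sum>i<n. dotp n ?e (v i) * v i l)"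
    have "dotp n ?y ?y = 0"
      using dotp_orthogonal_residual[OF _ on, of ?e] orthonormal_basis_coordinate_sum[OF on that] that
      by (simp add: dotp_unit_vector)
    then have "?y l = 0" using \<open>l < n\<close> unfolding dotp_self_eq_0_iff by blast
    then show ?thesis using that by (simp add: dotp_unit_vector)
  qed
  have "(\<Sum>i<n. dotp n x (v i) * v i l) = (\<Sum>i<n. \<Sum>p<n. x p * (v i p * v i l))"
    by (simp add: dotp_def sum_distrib_right mult.assoc)
  also have "\<dots> = (\<Sum>p<n. x p * (\<Sum>i<n. v i p * v i l))"
    by (subst sum.swap) (simp add: sum_distrib_left)
  also have "\<dots> = (\<Sum>p<n. if l = p then x p else 0)"
    using unit by (intro sum.cong) auto
  finally show ?thesis using \<open>l < n\<close> by simp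
qed

lemma parseval:
  assumes on: "orthonormal_family n {..<n} v"
  shows "(\<Sum>i<n. (dotp n x (v i))\<^sup>2) = dotp n x x"
proof -
  have "dotp n x x = dotp n x (\<lambda>l. \<Sum>i<n. dotp n x (v i) * v i l)"
    using orthonormal_basis_expansion[OF on, of _ x] by (intro dotp_cong) auto
  also have "\<dots> = (\<Sum>i<n. (dotp n x (v i))\<^sup>2)"
    unfolding dotp_sum_right dotp_scale_right by (simp add: power2_eq_square)
  finally show ?thesis ..
qed

section \<open>Eigenvectors of a symmetric matrix\<close>

lemma eigenvector_of_scale: "eigenvector_of n A \<mu> w \<Longrightarrow> eigenvector_of n A \<mu> (\<lambda>l. c * w l)"
  by (simp add: eigenvector_of_def dotp_scale_right)

lemma eigenvector_of_diff:
  "eigenvector_of n A \<mu> w \<Longrightarrow> eigenvector_of n A \<mu> w' \<Longrightarrow> eigenvector_of n A \<mu> (\<lambda>l. w l - w' l)"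
  by (simp add: eigenvector_of_def dotp_diff_right right_diff_distrib)

text \<open>Eliminates the eigenvalue as an unknown: it is a continuous function of matrix and
  eigenvector, so only vectors have to range over a compact set.\<close>

lemma eigenvalue_eq_quadratic_form:
  assumes "eigenvector_of n A \<mu> w" "dotp n w w = 1"
  shows "\<mu> = (\<Sum>i<n. w i * dotp n (A i) w)"
proof -
  have "(\<Sum>i<n. w i * dotp n (A i) w) = \<mu> * dotp n w w"
    using assms(1) by (simp add: eigenvector_of_def dotp_def[of n w w] sum_distrib_left ac_simps)
  then show ?thesis using assms(2) by simp
qed

lemma normalize_dotp:
  assumes "dotp n w w \<noteq> 0"
  shows "dotp n (\<lambda>l. inverse (sqrt (dotp n w w)) * w l) (\<lambda>l. inverse (sqrt (dotp n w w)) * w l) = 1"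
proof -
  have "0 < dotp n w w" using assms dotp_self_nonneg[of n w] by linarith
  then show ?thesis
    unfolding dotp_scale_left dotp_scale_right by (simp add: field_simps)
qed

lemma eigenvectors_orthogonal:
  assumes sym: "\<And>i j. i < n \<Longrightarrow> j < n \<Longrightarrow> A i j = A j i"
    and "eigenvector_of n A \<mu> w" "eigenvector_of n A \<mu>' w'" "\<mu> \<noteq> \<mu>'"
  shows "dotp n w w' = 0"
proof -
  have "\<mu> * dotp n w w' = (\<Sum>i<n. (\<mu> * w i) * w' i)"
    by (simp add: dotp_def sum_distrib_left mult.assoc)
  also have "\<dots> = (\<Sum>i<n. dotp n (A i) w * w' i)"
    using assms(2) by (simp add: eigenvector_of_def)
  also have "\<dots> = (\<Sum>i<n. \<Sum>j<n. A i j * w j * w' i)"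
    by (simp add: dotp_def sum_distrib_right)
  also have "\<dots> = (\<Sum>j<n. \<Sum>i<n. A j i * w' i * w j)"
    by (subst sum.swap, intro sum.cong refl) (use sym in auto)
  also have "\<dots> = (\<Sum>j<n. dotp n (A j) w' * w j)"
    by (simp add: dotp_def sum_distrib_right)
  also have "\<dots> = (\<Sum>j<n. \<mu>' * w' j * w j)"
    using assms(3) by (simp add: eigenvector_of_def)
  also have "\<dots> = \<mu>' * dotp n w w'"
    by (simp add: dotp_def sum_distrib_left ac_simps)
  finally show ?thesis using assms(4) by simp
qed

text \<open>Unit eigenvectors of distinct eigenvalues are orthonormal, so \<open>n + 1\<close>
  eigenvalues would contradict the bound on orthonormal families.\<close>

lemma finite_eigenvalues:
  assumes sym: "\<And>i j. i < n \<Longrightarrow> j < n \<Longrightarrow> A i j = A j i"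
  shows "finite {\<mu>. \<exists>w. dotp n w w = 1 \<and> eigenvector_of n A \<mu> w}" (is "finite ?E")
proof (rule ccontr)
  assume "infinite ?E"
  then obtain F where F: "F \<subseteq> ?E" "finite F" "card F = Suc n"
    using infinite_arbitrarily_large by blast
  obtain f where f: "bij_betw f {..<Suc n} F"
    using F ex_bij_betw_nat_finite[of F] by (auto simp: atLeast0LessThan)
  have "\<exists>w. dotp n w w = 1 \<and> eigenvector_of n A (f i) w" if "i < Suc n" for i
    using bij_betwE[OF f] that F(1) by blast
  then obtain v where v: "\<And>i. i < Suc n \<Longrightarrow> dotp n (v i) (v i) = 1 \<and> eigenvector_of n A (f i) (v i)"
    by metis
  have "orthonormal_family n {..<Suc n} v"
    unfolding orthonormal_family_def
  proof (intro ballI)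
    fix i j assume "i \<in> {..<Suc n}" "j \<in> {..<Suc n}"
    then have ij: "i < Suc n" "j < Suc n" by auto
    have "f i \<noteq> f j" if "i \<noteq> j"
      using f ij that by (auto simp: bij_betw_def inj_on_def)
    then show "dotp n (v i) (v j) = (if i = j then 1 else 0)"
      using v[OF ij(1)] v[OF ij(2)] eigenvectors_orthogonal[OF sym, where \<mu> = "f i" and w = "v i" and \<mu>' = "f j" and w' = "v j"] by auto
  qed
  from card_orthonormal_family_le[OF _ this] show False by simp
qed

text \<open>The part of \<open>w'\<close> orthogonal to \<open>w\<close> is again an eigenvector for
  the same eigenvalue; were it nonzero, normalising it would exhibit a double eigenvalue.\<close>

lemma simple_eigenvector_unique:
  assumes "\<not> double_eigenvalue n A"
    and w: "dotp n w w = 1" "eigenvector_of n A \<mu> w"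
    and w': "dotp n w' w' = 1" "eigenvector_of n A \<mu> w'"
  obtains c where "c\<^sup>2 = 1" "\<And>l. l < n \<Longrightarrow> w' l = c * w l"
proof -
  define c where "c = dotp n w w'"
  define y where "y = (\<lambda>l. w' l - c * w l)"
  have wy: "dotp n w y = 0" unfolding y_def dotp_diff_right dotp_scale_right by (simp add: c_def w)
  have y: "eigenvector_of n A \<mu> y"
    unfolding y_def by (intro eigenvector_of_diff eigenvector_of_scale w w')
  have "dotp n y y = 0"
  proof (rule ccontr)
    assume ne: "dotp n y y \<noteq> 0"
    let ?z = "\<lambda>l. inverse (sqrt (dotp n y y)) * y l"
    have "dotp n ?z ?z = 1" "eigenvector_of n A \<mu> ?z" "dotp n w ?z = 0"
      using normalize_dotp[OF ne] eigenvector_of_scale[OF y] wy by (auto simp: dotp_scale_right)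
    then show False using assms(1) w unfolding double_eigenvalue_def by blast
  qed
  then have eq: "\<And>l. l < n \<Longrightarrow> w' l = c * w l" unfolding dotp_self_eq_0_iff y_def by auto
  have "dotp n w' w' = c\<^sup>2 * dotp n w w"
    using dotp_cong[of n w' "\<lambda>l. c * w l" w' "\<lambda>l. c * w l"] eq
    by (simp add: dotp_scale_left dotp_scale_right power2_eq_square)
  then have "c\<^sup>2 = 1" using w w' by simp
  then show ?thesis using that eq by blast
qed

text \<open>A two-dimensional eigenspace meets the hyperplane where the last coordinate vanishes. A
  vector there is an eigenvector of the leading minor, and the last row of the eigenvalue equation
  becomes the orthogonality to \<open>A n\<close>.\<close>

lemma double_eigenvalue_Suc_imp:
  assumes "double_eigenvalue (Suc n) A"
  obtains z \<mu> where "dotp n z z = 1" "eigenvector_of n A \<mu> z" "dotp n (A n) z = 0"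
proof -
  obtain w w' \<mu> where w: "dotp (Suc n) w w = 1" "eigenvector_of (Suc n) A \<mu> w"
    and w': "dotp (Suc n) w' w' = 1" "eigenvector_of (Suc n) A \<mu> w'" and ww': "dotp (Suc n) w w' = 0"
    using assms unfolding double_eigenvalue_def by blast
  obtain y where y: "dotp (Suc n) y y \<noteq> 0" "eigenvector_of (Suc n) A \<mu> y" "y n = 0"
  proof (cases "w n = 0")
    case True then show ?thesis using that[of w] w by simp
  next
    case False
    \<comment> \<open>The combination that cancels coordinate \<open>n\<close>; by orthonormality
      its square length is the sum of the squared coefficients.\<close>
    let ?y = "\<lambda>l. w' n * w l - w n * w' l"
    have "dotp (Suc n) ?y ?y = (w' n)\<^sup>2 + (w n)\<^sup>2"
      by (simp add: dotp_diff_left dotp_diff_right dotp_scale_left dotp_scale_right w w' ww'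
          dotp_commute[of "Suc n" w' w] power2_eq_square)
    then have "dotp (Suc n) ?y ?y \<noteq> 0" using False by (simp add: sum_power2_eq_zero_iff)
    then show ?thesis using that[of ?y] eigenvector_of_diff eigenvector_of_scale w w' by simp
  qed
  let ?z = "\<lambda>l. inverse (sqrt (dotp (Suc n) y y)) * y l"
  have red: "dotp (Suc n) x ?z = dotp n x ?z" for x using y(3) by (simp add: dotp_def)
  have "dotp n ?z ?z = 1" using normalize_dotp[OF y(1)] red by simp
  moreover have "eigenvector_of (Suc n) A \<mu> ?z" using eigenvector_of_scale[OF y(2)] .
  ultimately show ?thesis
    using that[of ?z \<mu>] y(3) red unfolding eigenvector_of_def by auto
qed

section \<open>Uniqueness of the decomposition when the spectrum is simple\<close>

lemma spectral_decomp_orthonormal: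
  "spectral_decomp n A lam v \<Longrightarrow> orthonormal_family n {..<n} v"
  by (auto simp: spectral_decomp_def orthonormal_family_def dotp_def)

lemma spectral_decomp_eigenvector:
  assumes sd: "spectral_decomp n A lam v" and "i < n"
  shows "eigenvector_of n A (lam i) (v i)"
  unfolding eigenvector_of_def
proof (intro allI impI)
  fix p assume "p < n"
  have "dotp n (v i) (A p) = dotp n (v i) (\<lambda>q. \<Sum>j<n. (lam j * v j p) * v j q)"
    using sd \<open>p < n\<close> by (intro dotp_cong) (auto simp: spectral_decomp_def)
  also have "\<dots> = (\<Sum>j<n. if i = j then lam j * v j p else 0)"
    unfolding dotp_sum_right dotp_scale_right
    using spectral_decomp_orthonormal[OF sd] \<open>i < n\<close>
    by (intro sum.cong) (auto simp: orthonormal_family_def)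
  finally show "dotp n (A p) (v i) = lam i * v i p" using \<open>i < n\<close> by (simp add: dotp_commute)
qed

lemma spectral_decomp_strict:
  assumes sd: "spectral_decomp n A lam v" and "\<not> double_eigenvalue n A" "i < j" "j < n"
  shows "lam j < lam i"
proof -
  have "lam j \<le> lam i" using sd assms(3,4) by (auto simp: spectral_decomp_def)
  moreover have "lam j \<noteq> lam i"
  proof
    assume "lam j = lam i"
    then have "eigenvector_of n A (lam i) (v i)" "eigenvector_of n A (lam i) (v j)"
      using spectral_decomp_eigenvector[OF sd, of i] spectral_decomp_eigenvector[OF sd, of j] assms(3,4)
      by auto
    moreover have "dotp n (v i) (v i) = 1" "dotp n (v j) (v j) = 1" "dotp n (v i) (v j) = 0"
      using assms(3,4) spectral_decomp_orthonormal[OF sd] by (auto simp: orthonormal_family_def)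
    ultimately show False using assms(2) unfolding double_eigenvalue_def by blast
  qed
  ultimately show ?thesis by simp
qed

lemma spectral_decomp_symmetric:
  assumes "spectral_decomp n A lam v" "i < n" "j < n"
  shows "A i j = A j i"
  using assms by (simp add: spectral_decomp_def ac_simps)

text \<open>Every \<open>lam' k\<close> equals some \<open>lam (s k)\<close>, since otherwise
  \<open>v' k\<close> would be orthogonal to the whole basis \<open>v\<close>. Strict ordering makes
  \<open>s\<close> strictly increasing, so \<open>k \<le> s k\<close>, and monotonicity of
  \<open>lam\<close> concludes. Exchanging the roles gives equality.\<close>

lemma spectral_decomp_eigenvalue_le:
  assumes simple: "\<not> double_eigenvalue n A"
    and sd: "spectral_decomp n A lam v" and sd': "spectral_decomp n A lam' v'" and "j < n"
  shows "lam' j \<le> lam j"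
proof -
  have "\<exists>i<n. lam i = lam' k" if "k < n" for k
  proof (rule ccontr)
    assume no: "\<not> (\<exists>i<n. lam i = lam' k)"
    have "dotp n (v' k) (v i) = 0" if "i < n" for i
      by (rule eigenvectors_orthogonal[OF _ spectral_decomp_eigenvector[OF sd' \<open>k < n\<close>]
            spectral_decomp_eigenvector[OF sd that]])
        (use no that spectral_decomp_symmetric[OF sd] in auto)
    then have "dotp n (v' k) (v' k) = 0"
      unfolding parseval[OF spectral_decomp_orthonormal[OF sd], symmetric] by simp
    then show False using spectral_decomp_orthonormal[OF sd'] \<open>k < n\<close>
      by (auto simp: orthonormal_family_def)
  qed
  then obtain s where s: "\<And>k. k < n \<Longrightarrow> s k < n \<and> lam (s k) = lam' k" by metis
  have mono: "s i < s k" if "i < k" "k < n" for i k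
  proof (rule ccontr)
    assume "\<not> s i < s k"
    then have "s k \<le> s i" "s i < n" using s[of i] that by auto
    then have "lam (s i) \<le> lam (s k)"
      using sd unfolding spectral_decomp_def by blast
    then show False using spectral_decomp_strict[OF sd' simple that] s[of i] s[of k] that by simp
  qed
  have "k < n \<Longrightarrow> k \<le> s k" for k
  proof (induction k)
    case (Suc k) then show ?case using mono[of k "Suc k"] by simp
  qed simp
  then have "j \<le> s j" "s j < n" "lam (s j) = lam' j" using \<open>j < n\<close> s by auto
  then show ?thesis using sd unfolding spectral_decomp_def by metis
qed

lemma spectral_decomp_dotp_square_unique:
  assumes simple: "\<not> double_eigenvalue n A"
    and sd: "spectral_decomp n A lam v" and sd': "spectral_decomp n A lam' v'" and "j < n"
  shows "(dotp n (v' j) u)\<^sup>2 = (dotp n (v j) u)\<^sup>2"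
proof -
  have "lam' j = lam j"
    using spectral_decomp_eigenvalue_le[OF simple sd sd'] spectral_decomp_eigenvalue_le[OF simple sd' sd] \<open>j < n\<close>
    by (intro antisym) auto
  then have "eigenvector_of n A (lam j) (v' j)" "eigenvector_of n A (lam j) (v j)"
    using spectral_decomp_eigenvector[OF sd \<open>j < n\<close>] spectral_decomp_eigenvector[OF sd' \<open>j < n\<close>] by auto
  moreover have "dotp n (v j) (v j) = 1" "dotp n (v' j) (v' j) = 1"
    using spectral_decomp_orthonormal[OF sd] spectral_decomp_orthonormal[OF sd'] \<open>j < n\<close>
    by (auto simp: orthonormal_family_def)
  ultimately obtain c where c: "c\<^sup>2 = 1" "\<And>l. l < n \<Longrightarrow> v' j l = c * v j l"
    using simple_eigenvector_unique[OF simple] by metis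
  have "dotp n (v' j) u = c * dotp n (v j) u"
    unfolding dotp_scale_left[symmetric] using c(2) by (intro dotp_cong) auto
  then show ?thesis using c(1) by (simp add: power_mult_distrib)
qed

subsection \<open>Rotation invariance of Gaussian product measures\<close>

definition preserves_measure :: "'a measure \<Rightarrow> ('a \<Rightarrow> 'a) \<Rightarrow> bool" where
  "preserves_measure M T \<longleftrightarrow> T \<in> measurable M M \<and> distr M M T = M"

lemma preserves_measure_id: "preserves_measure M (\<lambda>x. x)"
  by (simp add: preserves_measure_def distr_id)

lemma preserves_measure_comp:
  assumes "preserves_measure M S" "preserves_measure M T"
  shows "preserves_measure M (\<lambda>x. S (T x))"
proof -
  have [measurable]: "S \<in> measurable M M" "T \<in> measurable M M"
    using assms by (auto simp: preserves_measure_def)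
  have "distr M M (\<lambda>x. S (T x)) = distr (distr M M T) M S"
    by (subst distr_distr) (auto simp: comp_def)
  then show ?thesis using assms by (simp add: preserves_measure_def)
qed

lemma preserves_measureI:
  assumes [measurable]: "T \<in> measurable M M"
    and eq: "\<And>f. f \<in> borel_measurable M \<Longrightarrow> (\<integral>\<^sup>+x. f (T x) \<partial>M) = (\<integral>\<^sup>+x. f x \<partial>M)"
  shows "preserves_measure M T"
proof -
  have "distr M M T = M"
  proof (rule measure_eqI)
    fix A assume "A \<in> sets (distr M M T)"
    then have [measurable]: "A \<in> sets M" by simp
    have "emeasure (distr M M T) A = (\<integral>\<^sup>+x. indicator A x \<partial>distr M M T)" by simp
    also have "\<dots> = (\<integral>\<^sup>+x. indicator A (T x) \<partial>M)" by (subst nn_integral_distr) auto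
    also have "\<dots> = (\<integral>\<^sup>+x. indicator A x \<partial>M)" by (rule eq) auto
    finally show "emeasure (distr M M T) A = emeasure M A" by simp
  qed simp
  then show ?thesis by (simp add: preserves_measure_def)
qed

abbreviation plane :: "(real \<times> real) measure" where
  "plane \<equiv> lborel \<Otimes>\<^sub>M lborel"

lemma nn_integral_shear_fst:
  assumes [measurable]: "f \<in> borel_measurable plane"
  shows "(\<integral>\<^sup>+z. f (fst z + t * snd z, snd z) \<partial>plane) = (\<integral>\<^sup>+z. f z \<partial>plane)"
proof -
  have "(\<integral>\<^sup>+z. f (fst z + t * snd z, snd z) \<partial>plane) = (\<integral>\<^sup>+y. \<integral>\<^sup>+x. f (x + t * y, y) \<partial>lborel \<partial>lborel)"
    by (subst lborel_pair.nn_integral_snd[symmetric]) auto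
  also have "\<dots> = (\<integral>\<^sup>+y. \<integral>\<^sup>+x. f (x, y) \<partial>lborel \<partial>lborel)"
  proof (rule nn_integral_cong)
    fix y :: real
    show "(\<integral>\<^sup>+x. f (x + t * y, y) \<partial>lborel) = (\<integral>\<^sup>+x. f (x, y) \<partial>lborel)"
      using nn_integral_real_affine[of "\<lambda>x. f (x, y)" 1 "t * y"] by (simp add: add.commute)
  qed
  also have "\<dots> = (\<integral>\<^sup>+z. f z \<partial>plane)"
    by (subst lborel_pair.nn_integral_snd) auto
  finally show ?thesis .
qed

lemma nn_integral_shear_snd:
  assumes [measurable]: "f \<in> borel_measurable plane"
  shows "(\<integral>\<^sup>+z. f (fst z, snd z + t * fst z) \<partial>plane) = (\<integral>\<^sup>+z. f z \<partial>plane)"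
proof -
  have "(\<integral>\<^sup>+z. f (fst z, snd z + t * fst z) \<partial>plane) = (\<integral>\<^sup>+x. \<integral>\<^sup>+y. f (x, y + t * x) \<partial>lborel \<partial>lborel)"
    by (subst lborel.nn_integral_fst[symmetric]) auto
  also have "\<dots> = (\<integral>\<^sup>+x. \<integral>\<^sup>+y. f (x, y) \<partial>lborel \<partial>lborel)"
  proof (rule nn_integral_cong)
    fix x :: real
    show "(\<integral>\<^sup>+y. f (x, y + t * x) \<partial>lborel) = (\<integral>\<^sup>+y. f (x, y) \<partial>lborel)"
      using nn_integral_real_affine[of "\<lambda>y. f (x, y)" 1 "t * x"] by (simp add: add.commute)
  qed
  also have "\<dots> = (\<integral>\<^sup>+z. f z \<partial>plane)"
    by (subst lborel.nn_integral_fst) auto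
  finally show ?thesis .
qed

text \<open>A plane rotation with nonzero sine is a product of three shears, each preserving
  Lebesgue measure by Fubini and translation invariance.\<close>

lemma nn_integral_rotation_plane:
  fixes c s :: real
  assumes [measurable]: "f \<in> borel_measurable plane" and cs: "c\<^sup>2 + s\<^sup>2 = 1"
  shows "(\<integral>\<^sup>+z. f (c * fst z - s * snd z, s * fst z + c * snd z) \<partial>plane) = (\<integral>\<^sup>+z. f z \<partial>plane)"
proof -
  have three: "(\<integral>\<^sup>+z. f (c * fst z - s * snd z, s * fst z + c * snd z) \<partial>plane) = (\<integral>\<^sup>+z. f z \<partial>plane)"
    if [measurable]: "f \<in> borel_measurable plane" and cs: "c\<^sup>2 + s\<^sup>2 = 1" and s: "s \<noteq> 0"
    for f :: "real \<times> real \<Rightarrow> ennreal" and c s :: real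
  proof -
    \<comment> \<open>The rotation is the product of shears with parameters \<open>t\<close>,
      \<open>s\<close>, \<open>t\<close>, where \<open>t\<close> is minus the tangent of half the
      angle; \<open>e1\<close> and \<open>e2\<close> are the identities between matrix entries that
      this needs.\<close>
    define t where "t = (c - 1) / s"
    have e1: "1 + s * t = c" using s by (simp add: t_def)
    have "t * (1 + c) = (c\<^sup>2 - 1) / s" by (simp add: t_def power2_eq_square algebra_simps)
    also have "c\<^sup>2 - 1 = - s * s" using cs by (simp add: power2_eq_square)
    finally have e2: "t + t * c = - s" using s by (simp add: algebra_simps)
    let ?f1 = "\<lambda>z. f (fst z + t * snd z, snd z)"
    let ?f2 = "\<lambda>z. ?f1 (fst z, snd z + s * fst z)"
    have R: "f (c * fst z - s * snd z, s * fst z + c * snd z) = ?f2 (fst z + t * snd z, snd z)" for z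
    proof -
      have y: "snd z + s * (fst z + t * snd z) = s * fst z + c * snd z"
        unfolding e1[symmetric] by (simp add: algebra_simps)
      have "fst z + t * snd z + t * (s * fst z + c * snd z) = (1 + s * t) * fst z + (t + t * c) * snd z"
        by (simp add: algebra_simps)
      also have "\<dots> = c * fst z - s * snd z" unfolding e1 e2 by simp
      finally show ?thesis unfolding fst_conv snd_conv y by simp
    qed
    show ?thesis
      unfolding R
      by (subst nn_integral_shear_fst[of ?f2], measurable)
        (subst nn_integral_shear_snd[of ?f1], measurable, rule nn_integral_shear_fst, measurable)
  qed
  show ?thesis
  proof (cases "s = 0")
    case False
    then show ?thesis using three assms by blast
  next
    case True
    then consider "c = 1" | "c = -1" using cs by (auto simp: power2_eq_1_iff)
    then show ?thesis
    proof cases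
      case 1 then show ?thesis using True by simp
    next
      case 2
      \<comment> \<open>The half turn has sine 0, so it is taken as two quarter turns, each of sine
        1.\<close>
      let ?g = "\<lambda>z. f (- snd z, fst z)"
      have "(\<integral>\<^sup>+z. f (c * fst z - s * snd z, s * fst z + c * snd z) \<partial>plane) = (\<integral>\<^sup>+z. ?g (- snd z, fst z) \<partial>plane)"
        using True 2 by simp
      also have "\<dots> = (\<integral>\<^sup>+z. ?g z \<partial>plane)" using three[of ?g 0 1] by simp
      also have "\<dots> = (\<integral>\<^sup>+z. f z \<partial>plane)" using three[of f 0 1] by simp
      finally show ?thesis .
    qed
  qed
qed

lemma prob_space_std_normal: "prob_space std_normal_distribution"
  by (rule prob_space_normal_density) simp

text \<open>The joint density \<open>\<rho>\<close> depends only on the norm, so invariance of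
  Lebesgue measure carries over. Iterated integrals are the form in which two coordinates split off
  a product measure.\<close>

lemma nn_integral_rotation_std_normal:
  fixes c s :: real
  assumes f: "f \<in> borel_measurable plane" and cs: "c\<^sup>2 + s\<^sup>2 = 1"
  shows "(\<integral>\<^sup>+x. \<integral>\<^sup>+y. f (c * x - s * y, s * x + c * y) \<partial>std_normal_distribution \<partial>std_normal_distribution) =
         (\<integral>\<^sup>+x. \<integral>\<^sup>+y. f (x, y) \<partial>std_normal_distribution \<partial>std_normal_distribution)"
proof -
  define \<rho> :: "real \<times> real \<Rightarrow> ennreal"
    where "\<rho> z = ennreal (std_normal_density (fst z) * std_normal_density (snd z))" for z
  note f[measurable]
  have [measurable]: "\<rho> \<in> borel_measurable plane" unfolding \<rho>_def by measurable
  have inv: "\<rho> (c * fst z - s * snd z, s * fst z + c * snd z) = \<rho> z" for z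
  proof -
    have "(c * fst z - s * snd z)\<^sup>2 + (s * fst z + c * snd z)\<^sup>2 = (c\<^sup>2 + s\<^sup>2) * ((fst z)\<^sup>2 + (snd z)\<^sup>2)"
      by (simp add: power2_eq_square algebra_simps)
    then show ?thesis unfolding \<rho>_def std_normal_density_def cs
      by (simp add: field_simps flip: exp_add)
  qed
  have conv: "(\<integral>\<^sup>+x. \<integral>\<^sup>+y. g (x, y) \<partial>std_normal_distribution \<partial>std_normal_distribution) = (\<integral>\<^sup>+z. \<rho> z * g z \<partial>plane)"
    if [measurable]: "g \<in> borel_measurable plane" for g :: "real \<times> real \<Rightarrow> ennreal"
  proof -
    have "(\<integral>\<^sup>+x. \<integral>\<^sup>+y. g (x, y) \<partial>std_normal_distribution \<partial>std_normal_distribution) =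
      (\<integral>\<^sup>+x. ennreal (std_normal_density x) * (\<integral>\<^sup>+y. ennreal (std_normal_density y) * g (x, y) \<partial>lborel) \<partial>lborel)"
      by (simp add: nn_integral_density)
    also have "\<dots> = (\<integral>\<^sup>+x. \<integral>\<^sup>+y. \<rho> (x, y) * g (x, y) \<partial>lborel \<partial>lborel)"
      by (subst nn_integral_cmult[symmetric]) (auto simp: \<rho>_def ennreal_mult' mult.assoc)
    also have "\<dots> = (\<integral>\<^sup>+z. \<rho> z * g z \<partial>plane)"
      by (subst lborel.nn_integral_fst[symmetric]) auto
    finally show ?thesis .
  qed
  have "(\<integral>\<^sup>+x. \<integral>\<^sup>+y. f (c * x - s * y, s * x + c * y) \<partial>std_normal_distribution \<partial>std_normal_distribution) =
    (\<integral>\<^sup>+z. \<rho> z * f (c * fst z - s * snd z, s * fst z + c * snd z) \<partial>plane)"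
    using conv[of "\<lambda>z. f (c * fst z - s * snd z, s * fst z + c * snd z)"] by simp
  also have "\<dots> = (\<integral>\<^sup>+z. \<rho> z * f z \<partial>plane)"
    using nn_integral_rotation_plane[of "\<lambda>z. \<rho> z * f z" c s] cs by (simp add: inv)
  finally show ?thesis by (simp add: conv)
qed

text \<open>Polymorphic in the index type: it rotates vectors, with numbers as indices, and also
  families of independent matrix entries, with pairs as indices.\<close>

definition rotate_coords :: "'i \<Rightarrow> 'i \<Rightarrow> real \<Rightarrow> real \<Rightarrow> ('i \<Rightarrow> real) \<Rightarrow> 'i \<Rightarrow> real" where
  "rotate_coords a b c s w = w(a := c * w a - s * w b, b := s * w a + c * w b)"

abbreviation std_gaussian :: "'i set \<Rightarrow> ('i \<Rightarrow> real) measure" where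
  "std_gaussian I \<equiv> PiM I (\<lambda>_. std_normal_distribution)"

lemma product_sigma_finite_std_normal: "product_sigma_finite (\<lambda>_. std_normal_distribution)"
  by (simp add: product_sigma_finite_def prob_space_imp_sigma_finite prob_space_std_normal)

lemma prob_space_std_gaussian: "prob_space (std_gaussian I)"
  by (intro prob_space_PiM prob_space_std_normal)

text \<open>Fubini integrates the coordinates \<open>a\<close> and \<open>b\<close> innermost; with
  all others frozen, the planar case applies.\<close>

lemma preserves_measure_rotate_coords:
  assumes "finite I" "a \<in> I" "b \<in> I" "a \<noteq> b" and cs: "c\<^sup>2 + s\<^sup>2 = 1"
  shows "preserves_measure (std_gaussian I) (rotate_coords a b c s)"
proof (rule preserves_measureI)
  show meas: "rotate_coords a b c s \<in> measurable (std_gaussian I) (std_gaussian I)"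
  proof (rule measurable_PiM_single')
    fix i assume "i \<in> I"
    then show "(\<lambda>w. rotate_coords a b c s w i) \<in> measurable (std_gaussian I) std_normal_distribution"
      using assms unfolding rotate_coords_def by (cases "i = a"; cases "i = b"; simp)
  qed (use assms in \<open>auto simp: rotate_coords_def space_PiM PiE_def extensional_def\<close>)
  fix f :: "_ \<Rightarrow> ennreal" assume f: "f \<in> borel_measurable (std_gaussian I)"
  define J where "J = I - {a, b}"
  have I: "I = insert b (insert a J)" "finite J" "a \<notin> J" "b \<notin> insert a J"
    using assms by (auto simp: J_def)
  interpret product_sigma_finite "\<lambda>_. std_normal_distribution" by (rule product_sigma_finite_std_normal)
  have split: "(\<integral>\<^sup>+w. g w \<partial>std_gaussian I) = (\<integral>\<^sup>+\<eta>. \<integral>\<^sup>+x. \<integral>\<^sup>+y. g (\<eta>(a := x, b := y))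
      \<partial>std_normal_distribution \<partial>std_normal_distribution \<partial>std_gaussian J)"
    if g: "g \<in> borel_measurable (std_gaussian I)" for g :: "_ \<Rightarrow> ennreal"
  proof -
    have [measurable]: "g \<in> borel_measurable (std_gaussian (insert b (insert a J)))" using g I by simp
    show ?thesis
      unfolding I(1) using I(2-4)
      by (subst product_nn_integral_insert, simp, simp, simp, subst product_nn_integral_insert) auto
  qed
  have fT: "(\<lambda>w. f (rotate_coords a b c s w)) \<in> borel_measurable (std_gaussian I)"
    using meas f by measurable
  have key: "(\<integral>\<^sup>+x. \<integral>\<^sup>+y. f (rotate_coords a b c s (\<eta>(a := x, b := y))) \<partial>std_normal_distribution \<partial>std_normal_distribution)
    = (\<integral>\<^sup>+x. \<integral>\<^sup>+y. f (\<eta>(a := x, b := y)) \<partial>std_normal_distribution \<partial>std_normal_distribution)"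
    if \<eta>: "\<eta> \<in> space (std_gaussian J)" for \<eta>
  proof -
    have "(\<lambda>z. \<eta>(a := fst z, b := snd z)) \<in> measurable plane (std_gaussian I)"
    proof (rule measurable_PiM_single')
      fix i assume "i \<in> I"
      then show "(\<lambda>z. (\<eta>(a := fst z, b := snd z)) i) \<in> measurable plane std_normal_distribution"
        using assms by (cases "i = a"; cases "i = b"; simp)
    qed (use \<eta> I in \<open>auto simp: space_PiM PiE_def extensional_def space_pair_measure\<close>)
    then have "(\<lambda>z. f (\<eta>(a := fst z, b := snd z))) \<in> borel_measurable plane"
      using f by measurable
    from nn_integral_rotation_std_normal[OF this cs] show ?thesis
      using \<open>a \<noteq> b\<close> by (simp add: rotate_coords_def fun_upd_twist)
  qed
  show "(\<integral>\<^sup>+w. f (rotate_coords a b c s w) \<partial>std_gaussian I) = (\<integral>\<^sup>+w. f w \<partial>std_gaussian I)"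
    unfolding split[OF f] split[OF fT] by (rule nn_integral_cong) (rule key)
qed

section \<open>Exponential moments of a standard normal variable\<close>

lemma nn_integral_normal_density:
  assumes "0 < \<sigma>" shows "(\<integral>\<^sup>+x. ennreal (normal_density \<mu> \<sigma> x) \<partial>lborel) = 1"
  using assms by (subst nn_integral_eq_integral) auto

text \<open>Completing the square: the exponential tilt moves the mean of the density to
  \<open>t\<close>.\<close>

lemma nn_integral_std_normal_exp_linear:
  "(\<integral>\<^sup>+x. ennreal (exp (t * x)) \<partial>std_normal_distribution) = ennreal (exp (t\<^sup>2 / 2))"
proof -
  have "std_normal_density x * exp (t * x) = exp (t\<^sup>2 / 2) * normal_density t 1 x" for x
    unfolding normal_density_def by (simp add: field_simps power2_eq_square flip: exp_add)
  then have "(\<integral>\<^sup>+x. ennreal (exp (t * x)) \<partial>std_normal_distribution) =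
    (\<integral>\<^sup>+x. ennreal (exp (t\<^sup>2 / 2)) * ennreal (normal_density t 1 x) \<partial>lborel)"
    by (simp add: nn_integral_density flip: ennreal_mult')
  then show ?thesis by (simp add: nn_integral_cmult nn_integral_normal_density)
qed

text \<open>The integrand is a multiple of the normal density of variance 1 / (1 - 2
  \<open>\<theta>\<close>), which is why \<open>\<theta>\<close> must stay below 1/2.\<close>

lemma nn_integral_std_normal_exp_square:
  assumes "\<theta> < 1/2"
  shows "(\<integral>\<^sup>+x. ennreal (exp (\<theta> * x\<^sup>2)) \<partial>std_normal_distribution) = ennreal (1 / sqrt (1 - 2 * \<theta>))"
proof -
  define \<sigma> where "\<sigma> = 1 / sqrt (1 - 2 * \<theta>)"
  have \<sigma>: "0 < \<sigma>" "\<sigma>\<^sup>2 = 1 / (1 - 2 * \<theta>)" using assms by (auto simp: \<sigma>_def power_divide)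
  have "std_normal_density x * exp (\<theta> * x\<^sup>2) = \<sigma> * normal_density 0 \<sigma> x" for x
  proof -
    have "- (x\<^sup>2) / (2 * \<sigma>\<^sup>2) = - x\<^sup>2 / 2 + \<theta> * x\<^sup>2" unfolding \<sigma>(2) by (simp add: field_simps)
    moreover have "sqrt (2 * pi * \<sigma>\<^sup>2) = sqrt (2 * pi) * \<sigma>" using \<sigma>(1) by (simp add: real_sqrt_mult)
    ultimately show ?thesis using \<sigma>(1)
      unfolding normal_density_def by (simp add: exp_add[symmetric])
  qed
  then have "(\<integral>\<^sup>+x. ennreal (exp (\<theta> * x\<^sup>2)) \<partial>std_normal_distribution) =
    (\<integral>\<^sup>+x. ennreal \<sigma> * ennreal (normal_density 0 \<sigma> x) \<partial>lborel)"
    using \<sigma>(1) by (simp add: nn_integral_density flip: ennreal_mult')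
  then show ?thesis using \<sigma>(1) by (simp add: nn_integral_cmult nn_integral_normal_density \<sigma>_def)
qed

subsection \<open>Conjugation invariance\<close>

definition upair :: "nat \<Rightarrow> nat \<Rightarrow> nat \<times> nat" where
  "upair p q = (min p q, max p q)"

text \<open>The GOE matrix built from standard normal entries, the diagonal being rescaled to variance 2.\<close>

definition gmat :: "(nat \<times> nat \<Rightarrow> real) \<Rightarrow> nat \<Rightarrow> nat \<Rightarrow> real" where
  "gmat w p q = (if p = q then sqrt 2 else 1) * w (upair p q)"

lemma upair_eq_iff: "upair p q = upair r s \<longleftrightarrow> (p = r \<and> q = s) \<or> (p = s \<and> q = r)"
  by (auto simp: upair_def min_def max_def split: if_splits)

lemma upair_commute: "upair p q = upair q p"
  by (simp add: upair_eq_iff)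

lemma upair_in_goe_index: "upair p q \<in> goe_index n \<longleftrightarrow> p < n \<and> q < n"
  by (auto simp: upair_def goe_index_def)

lemma finite_goe_index: "finite (goe_index n)"
  by (rule finite_subset[of _ "{..<n} \<times> {..<n}"]) (auto simp: goe_index_def)

lemma gmat_symmetric: "gmat w p q = gmat w q p"
  by (simp add: gmat_def upair_commute)

text \<open>This is R A R^T for the plane rotation R: the inner rotation acts within each row, the
  outer one across rows.\<close>

definition conjugate :: "nat \<Rightarrow> nat \<Rightarrow> real \<Rightarrow> real \<Rightarrow> (nat \<Rightarrow> nat \<Rightarrow> real) \<Rightarrow> nat \<Rightarrow> nat \<Rightarrow> real" where
  "conjugate i j c s A p q = rotate_coords i j c s (\<lambda>r. rotate_coords i j c s (A r) q) p"

lemma dotp_rotate_coords: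
  assumes "i < n" "j < n" "i \<noteq> j" and cs: "c\<^sup>2 + s\<^sup>2 = 1"
  shows "dotp n (rotate_coords i j c s x) (rotate_coords i j c s y) = dotp n x y"
proof -
  have split: "(\<Sum>l<n. f l) = f i + f j + (\<Sum>l\<in>{..<n} - {i} - {j}. f l)" for f :: "nat \<Rightarrow> real"
    using assms(1-3) by (simp add: sum.remove[of _ i] sum.remove[of _ j])
  have "(c * x i - s * x j) * (c * y i - s * y j) + (s * x i + c * x j) * (s * y i + c * y j)
    = (c\<^sup>2 + s\<^sup>2) * (x i * y i + x j * y j)"
    by (simp add: power2_eq_square algebra_simps)
  then show ?thesis unfolding dotp_def split rotate_coords_def using assms(3) by (simp add: cs)
qed

text \<open>Conjugation turns each term into the same multiple of a rotated rank-one matrix, so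
  eigenvalues and their order persist. \<open>B\<close> is compared inside the block only, because
  entries of the random matrix are controlled only there.\<close>

lemma spectral_decomp_conjugate:
  assumes ij: "i < n" "j < n" "i \<noteq> j" and cs: "c\<^sup>2 + s\<^sup>2 = 1"
    and sd: "spectral_decomp n A lam v"
    and B: "\<And>p q. p < n \<Longrightarrow> q < n \<Longrightarrow> B p q = conjugate i j c s A p q"
  shows "spectral_decomp n B lam (\<lambda>m. rotate_coords i j c s (v m))"
  unfolding spectral_decomp_def
proof (intro conjI)
  show "\<forall>i j. i \<le> j \<and> j < n \<longrightarrow> lam j \<le> lam i"
    using sd by (simp add: spectral_decomp_def)
  show "\<forall>i'<n. \<forall>j'<n. (\<Sum>l<n. rotate_coords i j c s (v i') l * rotate_coords i j c s (v j') l) =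
      (if i' = j' then 1 else 0)"
    using sd dotp_rotate_coords[OF ij cs] unfolding spectral_decomp_def dotp_def by simp
  have A: "A p q = (\<Sum>m<n. lam m * v m p * v m q)" if "p < n" "q < n" for p q
    using sd that by (simp add: spectral_decomp_def)
  have col: "rotate_coords i j c s (A p) q = (\<Sum>m<n. lam m * v m p * rotate_coords i j c s (v m) q)"
    if "p < n" "q < n" for p q
    using that ij A unfolding rotate_coords_def
    by (auto simp: sum_distrib_left algebra_simps sum.distrib sum_subtractf)
  have "conjugate i j c s A p q =
      (\<Sum>m<n. lam m * rotate_coords i j c s (v m) p * rotate_coords i j c s (v m) q)"
    if "p < n" "q < n" for p q
    unfolding conjugate_def using that ij col
    by (subst (1 3) rotate_coords_def) (auto simp: sum_distrib_left algebra_simps sum.distrib sum_subtractf)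
  then show "\<forall>p<n. \<forall>q<n. B p q =
      (\<Sum>m<n. lam m * rotate_coords i j c s (v m) p * rotate_coords i j c s (v m) q)"
    using B by simp
qed

text \<open>For each \<open>l\<close> outside \<open>{i, j}\<close> conjugation rotates the pair of
  entries (i, l), (j, l) by the same angle. These pairs are disjoint for different \<open>l\<close>,
  so the coordinate rotations can be composed one after another.\<close>

lemma rotate_off_diagonal_entries:
  assumes ij: "i < n" "j < n" "i \<noteq> j" and cs: "c\<^sup>2 + s\<^sup>2 = 1"
    and L: "finite L" "L \<subseteq> {..<n} - {i, j}"
  shows "\<exists>T. preserves_measure (std_gaussian (goe_index n)) T \<and>
    (\<forall>w. (\<forall>l\<in>L. T w (upair i l) = c * w (upair i l) - s * w (upair j l) \<and>
                 T w (upair j l) = s * w (upair i l) + c * w (upair j l)) \<and>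
         (\<forall>a. a \<notin> upair i ` L \<union> upair j ` L \<longrightarrow> T w a = w a))"
  using L
proof (induction L rule: finite_induct)
  case empty
  show ?case by (rule exI[of _ "\<lambda>w. w"]) (simp add: preserves_measure_id)
next
  case (insert l L)
  then have "\<exists>T. preserves_measure (std_gaussian (goe_index n)) T \<and>
    (\<forall>w. (\<forall>l\<in>L. T w (upair i l) = c * w (upair i l) - s * w (upair j l) \<and>
                 T w (upair j l) = s * w (upair i l) + c * w (upair j l)) \<and>
         (\<forall>a. a \<notin> upair i ` L \<union> upair j ` L \<longrightarrow> T w a = w a))" by simp
  then obtain T where T: "preserves_measure (std_gaussian (goe_index n)) T"
    and T': "\<forall>w. (\<forall>l\<in>L. T w (upair i l) = c * w (upair i l) - s * w (upair j l) \<and>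
                 T w (upair j l) = s * w (upair i l) + c * w (upair j l)) \<and>
         (\<forall>a. a \<notin> upair i ` L \<union> upair j ` L \<longrightarrow> T w a = w a)" by blast
  have T1: "T w (upair i m) = c * w (upair i m) - s * w (upair j m)"
    and T2: "T w (upair j m) = s * w (upair i m) + c * w (upair j m)" if "m \<in> L" for w m
    using T' that by blast+
  have T3: "T w a = w a" if "a \<notin> upair i ` L \<union> upair j ` L" for w a
    using T' that by blast
  let ?R = "rotate_coords (upair i l) (upair j l) c s"
  have l: "l < n" "l \<noteq> i" "l \<noteq> j" "l \<notin> L" "i \<notin> L" "j \<notin> L" using insert by auto
  \<comment> \<open>The pair belonging to the new \<open>l\<close> is still untouched, so rotating
    it now acts on the original entries.\<close>
  have Tl: "T w (upair i l) = w (upair i l)" "T w (upair j l) = w (upair j l)" for w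
    using l ij by (auto intro!: T3 simp: upair_eq_iff)
  have "preserves_measure (std_gaussian (goe_index n)) (\<lambda>w. ?R (T w))"
  proof (rule preserves_measure_comp[OF _ T])
    show "preserves_measure (std_gaussian (goe_index n)) ?R"
      by (rule preserves_measure_rotate_coords[OF finite_goe_index _ _ _ cs])
        (use l ij in \<open>auto simp: upair_in_goe_index upair_eq_iff\<close>)
  qed
  moreover have "?R (T w) (upair i m) = c * w (upair i m) - s * w (upair j m) \<and>
      ?R (T w) (upair j m) = s * w (upair i m) + c * w (upair j m)" if "m \<in> insert l L" for w m
    using that l ij T1[of m w] T2[of m w] Tl[of w] unfolding rotate_coords_def
    by (auto simp: upair_eq_iff)
  moreover have "?R (T w) a = w a" if "a \<notin> upair i ` insert l L \<union> upair j ` insert l L" for w a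
    using that T3[of a w] unfolding rotate_coords_def by auto
  ultimately show ?case by (intro exI[of _ "\<lambda>w. ?R (T w)"]) blast
qed

text \<open>In the coordinates p = (h1 + h2) / sqrt 2 and q = (h2 - h1) / sqrt 2 of the two normalised
  diagonal entries, conjugation fixes p and rotates q and the off-diagonal entry by twice the angle.\<close>

lemma rotate_diagonal_entries:
  assumes ij: "i < n" "j < n" "i \<noteq> j" and cs: "c\<^sup>2 + s\<^sup>2 = 1"
  shows "\<exists>T. preserves_measure (std_gaussian (goe_index n)) T \<and>
    (\<forall>w. T w (upair i j) = (c\<^sup>2 - s\<^sup>2) * w (upair i j) + c * s * sqrt 2 * (w (upair i i) - w (upair j j)) \<and>
         sqrt 2 * T w (upair i i) = c\<^sup>2 * sqrt 2 * w (upair i i) - 2 * c * s * w (upair i j) + s\<^sup>2 * sqrt 2 * w (upair j j) \<and>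
         sqrt 2 * T w (upair j j) = s\<^sup>2 * sqrt 2 * w (upair i i) + 2 * c * s * w (upair i j) + c\<^sup>2 * sqrt 2 * w (upair j j) \<and>
         (\<forall>a. a \<notin> {upair i i, upair j j, upair i j} \<longrightarrow> T w a = w a))"
proof -
  let ?r = "sqrt 2 / 2"
  \<comment> \<open>Cosine and sine of the doubled angle. Since the diagonal has variance 2, q is
    half the difference of the two diagonal matrix entries and has variance 1 like the off-diagonal
    entry, so the pair is rotated rather than distorted. \<open>?R1\<close> passes to p and q, and
    \<open>?R3\<close> undoes it.\<close>
  let ?C = "c\<^sup>2 - s\<^sup>2" and ?S = "2 * c * s"
  let ?R1 = "rotate_coords (upair i i) (upair j j) ?r (- ?r)"
  let ?R2 = "rotate_coords (upair i j) (upair j j) ?C ?S"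
  let ?R3 = "rotate_coords (upair i i) (upair j j) ?r ?r"
  let ?T = "\<lambda>w. ?R3 (?R2 (?R1 w))"
  have r: "?r\<^sup>2 + (- ?r)\<^sup>2 = 1" "?r\<^sup>2 + ?r\<^sup>2 = 1" by (simp_all add: power_divide)
  have "?C\<^sup>2 + ?S\<^sup>2 = (c\<^sup>2 + s\<^sup>2)\<^sup>2" by (simp add: power2_eq_square algebra_simps)
  then have CS: "?C\<^sup>2 + ?S\<^sup>2 = 1" using cs by simp
  have ne: "upair i i \<noteq> upair j j" "upair i j \<noteq> upair j j" "upair i i \<noteq> upair i j"
    using ij by (auto simp: upair_eq_iff)
  have pres: "preserves_measure (std_gaussian (goe_index n)) ?T"
  proof (rule preserves_measure_comp[of _ ?R3 "\<lambda>w. ?R2 (?R1 w)"])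
    show "preserves_measure (std_gaussian (goe_index n)) ?R3"
      using ij ne by (intro preserves_measure_rotate_coords finite_goe_index r) (auto simp: upair_in_goe_index)
    show "preserves_measure (std_gaussian (goe_index n)) (\<lambda>w. ?R2 (?R1 w))"
    proof (rule preserves_measure_comp[of _ ?R2 ?R1])
      show "preserves_measure (std_gaussian (goe_index n)) ?R2"
        using ij ne by (intro preserves_measure_rotate_coords finite_goe_index CS) (auto simp: upair_in_goe_index)
      show "preserves_measure (std_gaussian (goe_index n)) ?R1"
        using ij ne by (intro preserves_measure_rotate_coords finite_goe_index r) (auto simp: upair_in_goe_index)
    qed
  qed
  have kk: "sqrt 2 * (sqrt 2 * x) = 2 * x" for x :: real by (simp flip: mult.assoc)
  have c2: "c\<^sup>2 = 1 - s\<^sup>2" using cs by simp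
  have "?T w (upair i j) = ?C * w (upair i j) + c * s * sqrt 2 * (w (upair i i) - w (upair j j))" for w
    using ne unfolding rotate_coords_def by (simp add: algebra_simps)
  moreover have "sqrt 2 * ?T w (upair i i) =
      c\<^sup>2 * sqrt 2 * w (upair i i) - 2 * c * s * w (upair i j) + s\<^sup>2 * sqrt 2 * w (upair j j)" for w
    using ne unfolding rotate_coords_def by (simp add: c2 kk algebra_simps add_divide_distrib diff_divide_distrib)
  moreover have "sqrt 2 * ?T w (upair j j) =
      s\<^sup>2 * sqrt 2 * w (upair i i) + 2 * c * s * w (upair i j) + c\<^sup>2 * sqrt 2 * w (upair j j)" for w
    using ne unfolding rotate_coords_def by (simp add: c2 kk algebra_simps add_divide_distrib diff_divide_distrib)
  moreover have "?T w a = w a" if "a \<notin> {upair i i, upair j j, upair i j}" for w a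
    using that unfolding rotate_coords_def by simp
  ultimately show ?thesis using pres by (intro exI[of _ ?T]) blast
qed

text \<open>\<open>T\<close> handles the entries with exactly one index in \<open>{i, j}\<close> and
  \<open>D\<close> the 2 by 2 block; they move disjoint sets of entries, so each entry of the
  composite is read off from one of them.\<close>

lemma gmat_conjugation_invariant:
  assumes ij: "i < n" "j < n" "i \<noteq> j" and cs: "c\<^sup>2 + s\<^sup>2 = 1"
  obtains T where "preserves_measure (std_gaussian (goe_index n)) T"
    and "\<And>w p q. p < n \<Longrightarrow> q < n \<Longrightarrow> gmat (T w) p q = conjugate i j c s (gmat w) p q"
proof -
  let ?L = "{..<n} - {i, j}"
  obtain T where T: "preserves_measure (std_gaussian (goe_index n)) T"
    and T1: "\<And>w m. m \<in> ?L \<Longrightarrow> T w (upair i m) = c * w (upair i m) - s * w (upair j m)"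
    and T2: "\<And>w m. m \<in> ?L \<Longrightarrow> T w (upair j m) = s * w (upair i m) + c * w (upair j m)"
    and T3: "\<And>w a. a \<notin> upair i ` ?L \<union> upair j ` ?L \<Longrightarrow> T w a = w a"
    using rotate_off_diagonal_entries[OF ij cs, of ?L] by auto
  obtain D where D: "preserves_measure (std_gaussian (goe_index n)) D"
    and D1: "\<And>w. D w (upair i j) = (c\<^sup>2 - s\<^sup>2) * w (upair i j) + c * s * sqrt 2 * (w (upair i i) - w (upair j j))"
    and D2: "\<And>w. sqrt 2 * D w (upair i i) = c\<^sup>2 * sqrt 2 * w (upair i i) - 2 * c * s * w (upair i j) + s\<^sup>2 * sqrt 2 * w (upair j j)"
    and D3: "\<And>w. sqrt 2 * D w (upair j j) = s\<^sup>2 * sqrt 2 * w (upair i i) + 2 * c * s * w (upair i j) + c\<^sup>2 * sqrt 2 * w (upair j j)"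
    and D4: "\<And>w a. a \<notin> {upair i i, upair j j, upair i j} \<Longrightarrow> D w a = w a"
    using rotate_diagonal_entries[OF ij cs] by auto
  have Td: "T w (upair i j) = w (upair i j)" "T w (upair i i) = w (upair i i)" "T w (upair j j) = w (upair j j)" for w
    by (rule T3; use ij in \<open>auto simp: upair_eq_iff\<close>)+
  show ?thesis
  proof (rule that[of "\<lambda>w. D (T w)"])
    show "preserves_measure (std_gaussian (goe_index n)) (\<lambda>w. D (T w))"
      by (rule preserves_measure_comp[OF D T])
    fix w p q assume pq: "p < n" "q < n"
    have ji: "upair j i = upair i j" by (rule upair_commute)
    consider "p \<in> {i, j}" "q \<in> {i, j}" | "p \<in> {i, j}" "q \<in> ?L" | "p \<in> ?L" "q \<in> {i, j}" | "p \<in> ?L" "q \<in> ?L"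
      using pq by blast
    then show "gmat (D (T w)) p q = conjugate i j c s (gmat w) p q"
    proof cases
      case 1
      then show ?thesis using ij
        unfolding gmat_def conjugate_def rotate_coords_def
        by (auto simp: D1 D2 D3 Td ji algebra_simps power2_eq_square)
    next
      case 2
      then have "D (T w) (upair p q) = T w (upair p q)"
        by (intro D4) (auto simp: upair_eq_iff)
      then show ?thesis using 2 ij T1[of q w] T2[of q w]
        unfolding gmat_def conjugate_def rotate_coords_def by auto
    next
      case 3
      then have "D (T w) (upair p q) = T w (upair q p)"
        by (subst D4) (auto simp: upair_eq_iff upair_commute)
      then show ?thesis using 3 ij T1[of p w] T2[of p w]
        unfolding gmat_def conjugate_def rotate_coords_def by (auto simp: upair_commute[of p])
    next
      case 4
      then have "D (T w) (upair p q) = T w (upair p q)"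
        by (intro D4) (auto simp: upair_eq_iff)
      also have "\<dots> = w (upair p q)" using 4 by (intro T3) (auto simp: upair_eq_iff)
      finally show ?thesis using 4
        unfolding gmat_def conjugate_def rotate_coords_def by auto
    qed
  qed
qed

subsection \<open>Measurability of spectral events\<close>

text \<open>Value at \<open>u\<close> of the quadratic form with matrix the signed sum of the
  projections onto the \<open>v i\<close>; for \<open>u\<close> the k-th coordinate vector it
  carries the whole leading term of the diagonal entry of Z.\<close>

definition half_deviation :: "nat \<Rightarrow> (nat \<Rightarrow> nat \<Rightarrow> real) \<Rightarrow> (nat \<Rightarrow> real) \<Rightarrow> real" where
  "half_deviation n v u = (\<Sum>i<n. sgn_half n i * (dotp n (v i) u)\<^sup>2)"

text \<open>Existential in the decomposition, so that it covers every possible choice; the weak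
  inequality keeps it closed.\<close>

definition bad_matrices :: "nat \<Rightarrow> real \<Rightarrow> (nat \<Rightarrow> real) \<Rightarrow> (nat \<Rightarrow> nat \<Rightarrow> real) set" where
  "bad_matrices n t u = {A. \<exists>lam v. spectral_decomp n A lam v \<and> t \<le> \<bar>half_deviation n v u\<bar>}"

text \<open>Tube lemma: projecting along a compact factor is a closed map.\<close>

lemma closed_compact_projection_general:
  fixes K :: "'a::topological_space set" and S :: "('a \<times> 'b::topological_space) set"
  assumes "compact K" "closed S"
  shows "closed {y. \<exists>x\<in>K. (x, y) \<in> S}"
proof -
  have "closed_map (prod_topology (top_of_set K) euclidean) (euclidean :: 'b topology) snd"
    by (rule Abstract_Topological_Spaces.closed_map_snd) (simp add: assms(1) compact_space_subtopology)
  moreover have "closedin (prod_topology (top_of_set K) euclidean) (S \<inter> K \<times> UNIV)"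
  proof -
    have "prod_topology (top_of_set K) (euclidean :: 'b topology) = top_of_set (K \<times> UNIV)"
      by (metis subtopology_UNIV prod_topology_euclidean subtopology_Times)
    then show ?thesis using assms(2) by (metis closedin_closed_Int inf_commute)
  qed
  ultimately have "closed (snd ` (S \<inter> K \<times> UNIV))"
    by (simp add: closed_map_def)
  moreover have "snd ` (S \<inter> K \<times> UNIV) = {y. \<exists>x\<in>K. (x, y) \<in> S}" by force
  ultimately show ?thesis by simp
qed

text \<open>A product over all natural indices, compact by Tychonoff. Unit vectors of length
  \<open>n\<close>, set to 0 beyond \<open>n\<close>, lie in it.\<close>

definition cube :: "(nat \<Rightarrow> real) set" where "cube = {x. \<forall>l. \<bar>x l\<bar> \<le> 1}"

lemma compact_PiE_UNIV:
  fixes S :: "'b::topological_space set"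
  assumes "compact S"
  shows "compact {f :: 'a \<Rightarrow> 'b. \<forall>i. f i \<in> S}"
proof -
  have "compactin (product_topology (\<lambda>_. euclidean) (UNIV :: 'a set)) (PiE UNIV (\<lambda>_. S))"
    using assms by (simp add: compactin_PiE)
  moreover have "PiE UNIV (\<lambda>_. S) = {f :: 'a \<Rightarrow> 'b. \<forall>i. f i \<in> S}" by auto
  ultimately show ?thesis by (simp add: euclidean_product_topology)
qed

lemma compact_cube: "compact cube"
proof -
  have "cube = {f. \<forall>l. f l \<in> {-1..1}}" by (auto simp: cube_def abs_le_iff)
  then show ?thesis using compact_PiE_UNIV[OF compact_Icc[of "-1::real" 1]] by metis
qed

lemma continuous_on_coordinates:
  "continuous_on UNIV (\<lambda>z :: (nat \<Rightarrow> nat \<Rightarrow> real) \<times> 'a::topological_space. fst z i l)"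
  "continuous_on UNIV (\<lambda>z :: 'a \<times> (nat \<Rightarrow> nat \<Rightarrow> real). snd z i l)"
  "continuous_on UNIV (\<lambda>z :: (nat \<Rightarrow> real) \<times> 'a. fst z l)"
  "continuous_on UNIV (\<lambda>z :: ((nat \<Rightarrow> real) \<times> 'b::topological_space) \<times> 'a. fst (fst z) l)"
  "continuous_on UNIV (\<lambda>z :: ('b \<times> (nat \<Rightarrow> real)) \<times> 'a. snd (fst z) l)"
proof -
  note co = continuous_on_product_then_coordinatewise
  note f = continuous_on_fst[OF continuous_on_id] and s = continuous_on_snd[OF continuous_on_id]
  show "continuous_on UNIV (\<lambda>z :: (nat \<Rightarrow> nat \<Rightarrow> real) \<times> 'a. fst z i l)" by (rule co[OF co[OF f]])
  show "continuous_on UNIV (\<lambda>z :: 'a \<times> (nat \<Rightarrow> nat \<Rightarrow> real). snd z i l)" by (rule co[OF co[OF s]])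
  show "continuous_on UNIV (\<lambda>z :: (nat \<Rightarrow> real) \<times> 'a. fst z l)" by (rule co[OF f])
  show "continuous_on UNIV (\<lambda>z :: ((nat \<Rightarrow> real) \<times> 'b) \<times> 'a. fst (fst z) l)"
    by (rule co[OF continuous_on_fst[OF f]])
  show "continuous_on UNIV (\<lambda>z :: ('b \<times> (nat \<Rightarrow> real)) \<times> 'a. snd (fst z) l)"
    by (rule co[OF continuous_on_snd[OF f]])
qed

lemma abs_le_1_if_dotp_self_eq_1:
  assumes "dotp n x x = 1" "l < n"
  shows "\<bar>x l\<bar> \<le> 1"
proof -
  have "(x l)\<^sup>2 \<le> dotp n x x"
    unfolding dotp_def power2_eq_square using assms(2) by (intro member_le_sum) auto
  then show ?thesis using assms(1) by (simp add: abs_square_le_1)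
qed

abbreviation quadratic_form :: "nat \<Rightarrow> (nat \<Rightarrow> nat \<Rightarrow> real) \<Rightarrow> (nat \<Rightarrow> real) \<Rightarrow> real" where
  "quadratic_form n A x \<equiv> (\<Sum>p<n. x p * dotp n (A p) x)"

lemma closed_Collect_all_less:
  assumes "\<And>i::nat. i < n \<Longrightarrow> closed {x. P i x}"
  shows "closed {x. \<forall>i<n. P i x}"
proof -
  have "{x. \<forall>i<n. P i x} = (\<Inter>i<n. {x. P i x})" by auto
  then show ?thesis using assms by auto
qed

lemma continuous_on_dotp:
  assumes "\<And>l. continuous_on S (\<lambda>z. f z l)" "\<And>l. continuous_on S (\<lambda>z. g z l)"
  shows "continuous_on S (\<lambda>z. dotp n (f z) (g z))"
  unfolding dotp_def by (intro continuous_intros assms)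

lemma closed_eigenvector_of:
  assumes "\<And>i j. continuous_on UNIV (\<lambda>z. f z i j)" "continuous_on UNIV g"
    and "\<And>j. continuous_on UNIV (\<lambda>z. h z j)"
  shows "closed {z. eigenvector_of n (f z) (g z) (h z)}"
  unfolding eigenvector_of_def
  by (intro closed_Collect_all_less closed_Collect_eq continuous_on_mult continuous_on_dotp assms)

lemma closed_bad_matrices: "closed (bad_matrices n t u)"
proof -
  \<comment> \<open>With eigenvalues written as quadratic forms, the projection runs over the
    vectors alone, which stay in a compact set.\<close>
  define S where "S = {(v, A). spectral_decomp n A (\<lambda>i. quadratic_form n A (v i)) v \<and> t \<le> \<bar>half_deviation n v u\<bar>}"
  define K where "K = {v :: nat \<Rightarrow> nat \<Rightarrow> real. \<forall>i. v i \<in> cube}"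
  \<comment> \<open>All quantifiers are brought into bounded form, so that closedness follows by
    finite intersections.\<close>
  have "spectral_decomp n A lam v \<longleftrightarrow>
     (\<forall>j<n. \<forall>i<Suc j. lam j \<le> lam i) \<and>
     (\<forall>i<n. \<forall>j<n. dotp n (v i) (v j) = (if i = j then 1 else 0)) \<and>
     (\<forall>p<n. \<forall>q<n. A p q = (\<Sum>i<n. lam i * v i p * v i q))" for A lam v
    by (auto simp: spectral_decomp_def dotp_def less_Suc_eq_le)
  then have "S = {z. (\<forall>j<n. \<forall>i<Suc j. quadratic_form n (snd z) (fst z j) \<le> quadratic_form n (snd z) (fst z i)) \<and>
     (\<forall>i<n. \<forall>j<n. dotp n (fst z i) (fst z j) = (if i = j then 1 else 0)) \<and>
     (\<forall>p<n. \<forall>q<n. snd z p q = (\<Sum>i<n. quadratic_form n (snd z) (fst z i) * fst z i p * fst z i q)) \<and>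
     t \<le> \<bar>half_deviation n (fst z) u\<bar>}"
    by (auto simp: S_def)
  then have "closed S"
    unfolding half_deviation_def
    by (simp only:) (intro closed_Collect_conj closed_Collect_all_less closed_Collect_le closed_Collect_eq
        continuous_on_const continuous_on_rabs continuous_on_sum continuous_on_mult continuous_on_power
        continuous_on_dotp continuous_on_coordinates)
  moreover have "compact K" unfolding K_def by (intro compact_PiE_UNIV compact_cube)
  moreover have "bad_matrices n t u = {A. \<exists>v\<in>K. (v, A) \<in> S}"
  proof safe
    fix A assume "A \<in> bad_matrices n t u"
    then obtain lam v where sd: "spectral_decomp n A lam v" and t: "t \<le> \<bar>half_deviation n v u\<bar>"
      by (auto simp: bad_matrices_def)
    \<comment> \<open>The decomposition constrains only indices below \<open>n\<close>; the others
      are reset to 0 to land in \<open>K\<close>.\<close>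
    define v' where "v' = (\<lambda>i l. if i < n \<and> l < n then v i l else 0)"
    have v1: "dotp n (v i) (v i) = 1" if "i < n" for i
      using spectral_decomp_orthonormal[OF sd] that by (simp add: orthonormal_family_def)
    have v'K: "v' \<in> K"
      using abs_le_1_if_dotp_self_eq_1[OF v1] by (auto simp: K_def cube_def v'_def)
    have eq: "dotp n x (v' i) = dotp n x (v i)" if "i < n" for x i
      using that by (intro dotp_cong) (auto simp: v'_def)
    have lam: "quadratic_form n A (v' i) = lam i" if "i < n" for i
      using eigenvalue_eq_quadratic_form[OF spectral_decomp_eigenvector[OF sd that] v1[OF that]] eq[OF that] that
      by (simp add: v'_def)
    have "spectral_decomp n A (\<lambda>i. quadratic_form n A (v' i)) v'"
      using sd unfolding spectral_decomp_def by (auto simp: lam) (auto simp: v'_def)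
    moreover have "half_deviation n v' u = half_deviation n v u"
      unfolding half_deviation_def by (intro sum.cong refl) (simp add: eq dotp_commute[of n _ u])
    ultimately have "(v', A) \<in> S" using t by (simp add: S_def)
    then show "\<exists>v\<in>K. (v, A) \<in> S" using v'K by blast
  qed (auto simp: S_def bad_matrices_def)
  ultimately show ?thesis using closed_compact_projection_general by simp
qed

lemma truncate_in_cube:
  assumes "dotp n w w = 1"
  shows "(\<lambda>l. if l < n then w l else 0) \<in> cube"
  using abs_le_1_if_dotp_self_eq_1[OF assms] by (auto simp: cube_def)

lemma dotp_truncate:
  "dotp n x (\<lambda>l. if l < n then w l else 0) = dotp n x w"
  "dotp n (\<lambda>l. if l < n then w l else 0) x = dotp n w x"
  by (auto intro: dotp_cong)

lemma eigenvector_of_truncate: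
  "eigenvector_of n A \<mu> (\<lambda>l. if l < n then w l else 0) \<longleftrightarrow> eigenvector_of n A \<mu> w"
  by (auto simp: eigenvector_of_def dotp_truncate)

lemma closed_double_eigenvalue: "closed {A. double_eigenvalue n A}"
proof -
  \<comment> \<open>The quadratic form of the first vector serves for both, which builds equality of
    the two eigenvalues into the closed condition.\<close>
  define S where "S = {(x, A). dotp n (fst x) (fst x) = 1 \<and> dotp n (snd x) (snd x) = 1 \<and> dotp n (fst x) (snd x) = 0 \<and>
    eigenvector_of n A (quadratic_form n A (fst x)) (fst x) \<and> eigenvector_of n A (quadratic_form n A (fst x)) (snd x)}"
  have S: "S = {z. dotp n (fst (fst z)) (fst (fst z)) = 1 \<and> dotp n (snd (fst z)) (snd (fst z)) = 1 \<and>
    dotp n (fst (fst z)) (snd (fst z)) = 0 \<and>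
    eigenvector_of n (snd z) (quadratic_form n (snd z) (fst (fst z))) (fst (fst z)) \<and>
    eigenvector_of n (snd z) (quadratic_form n (snd z) (fst (fst z))) (snd (fst z))}"
    by (auto simp: S_def)
  have "closed S"
    unfolding S by (intro closed_Collect_conj closed_Collect_eq closed_eigenvector_of
        continuous_on_const continuous_on_sum continuous_on_mult continuous_on_power
        continuous_on_dotp continuous_on_coordinates)
  moreover have "compact (cube \<times> cube)" by (intro compact_Times compact_cube)
  moreover have "{A. double_eigenvalue n A} = {A. \<exists>x\<in>cube \<times> cube. (x, A) \<in> S}"
  proof safe
    fix A assume "double_eigenvalue n A"
    then obtain w w' \<mu> where w: "dotp n w w = 1" "dotp n w' w' = 1" "dotp n w w' = 0"
      "eigenvector_of n A \<mu> w" "eigenvector_of n A \<mu> w'" by (auto simp: double_eigenvalue_def)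
    let ?t = "\<lambda>w l. if l < n then w l else (0::real)"
    have "quadratic_form n A (?t w) = \<mu>"
      using eigenvalue_eq_quadratic_form[OF w(4,1)] by (simp add: dotp_truncate)
    then have "((?t w, ?t w'), A) \<in> S"
      using w by (simp add: S_def dotp_truncate eigenvector_of_truncate)
    moreover have "(?t w, ?t w') \<in> cube \<times> cube" using w truncate_in_cube by blast
    ultimately show "\<exists>x\<in>cube \<times> cube. (x, A) \<in> S" by blast
  next
    fix A w w' assume "((w, w'), A) \<in> S"
    then show "double_eigenvalue n A" unfolding S_def double_eigenvalue_def by auto
  qed
  ultimately show ?thesis using closed_compact_projection_general by (simp only:)
qed

text \<open>The last condition holds for some coordinate of any unit vector; unlike \<open>z i \<noteq> 0\<close> it is closed.\<close>

definition row_orthogonal_eigenvector :: "nat \<Rightarrow> nat \<Rightarrow> (nat \<Rightarrow> nat \<Rightarrow> real) \<Rightarrow> bool" where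
  "row_orthogonal_eigenvector n i A \<longleftrightarrow> (\<exists>z \<mu>. dotp n z z = 1 \<and> eigenvector_of n A \<mu> z \<and>
     dotp n (A n) z = 0 \<and> 1 \<le> real n * (z i)\<^sup>2)"

lemma closed_row_orthogonal_eigenvector:
  assumes "i < n"
  shows "closed {A. row_orthogonal_eigenvector n i A}"
proof -
  define S where "S = {(x, A). dotp n x x = 1 \<and> eigenvector_of n A (quadratic_form n A x) x \<and>
     dotp n (A n) x = 0 \<and> 1 \<le> real n * (x i)\<^sup>2}"
  have S: "S = {z. dotp n (fst z) (fst z) = 1 \<and> eigenvector_of n (snd z) (quadratic_form n (snd z) (fst z)) (fst z) \<and>
     dotp n (snd z n) (fst z) = 0 \<and> 1 \<le> real n * (fst z i)\<^sup>2}"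
    by (auto simp: S_def)
  have "closed S"
    unfolding S by (intro closed_Collect_conj closed_Collect_eq closed_Collect_le closed_eigenvector_of
        continuous_on_const continuous_on_sum continuous_on_mult continuous_on_power
        continuous_on_dotp continuous_on_coordinates)
  moreover have "{A. row_orthogonal_eigenvector n i A} = {A. \<exists>x\<in>cube. (x, A) \<in> S}"
  proof safe
    fix A assume "row_orthogonal_eigenvector n i A"
    then obtain z \<mu> where z: "dotp n z z = 1" "eigenvector_of n A \<mu> z" "dotp n (A n) z = 0" "1 \<le> real n * (z i)\<^sup>2"
      by (auto simp: row_orthogonal_eigenvector_def)
    let ?z = "\<lambda>l. if l < n then z l else 0"
    have "quadratic_form n A ?z = \<mu>"
      using eigenvalue_eq_quadratic_form[OF z(2,1)] by (simp add: dotp_truncate)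
    then have "(?z, A) \<in> S"
      using z assms by (simp add: S_def dotp_truncate eigenvector_of_truncate)
    then show "\<exists>x\<in>cube. (x, A) \<in> S" using truncate_in_cube[OF z(1)] by blast
  qed (auto simp: S_def row_orthogonal_eigenvector_def)
  ultimately show ?thesis using closed_compact_projection_general compact_cube by simp
qed

section \<open>Pulling closed matrix events back to the independent entries\<close>

lemma measurable_gmat: "gmat \<in> borel_measurable (std_gaussian (goe_index n))"
proof (rule measurable_coordinatewise_then_product, rule measurable_coordinatewise_then_product)
  fix p q
  show "(\<lambda>w. gmat w p q) \<in> borel_measurable (std_gaussian (goe_index n))"
  proof (cases "upair p q \<in> goe_index n")
    case True
    then have "(\<lambda>w. w (upair p q)) \<in> measurable (std_gaussian (goe_index n)) std_normal_distribution"
      by (rule measurable_component_singleton)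
    then have [measurable]: "(\<lambda>w. w (upair p q)) \<in> borel_measurable (std_gaussian (goe_index n))"
      by simp
    show ?thesis unfolding gmat_def by measurable
  next
    case False
    \<comment> \<open>Points of the product space are extensional, so entries outside the index set
      are constant and hence measurable.\<close>
    then have "w (upair p q) = undefined" if "w \<in> space (std_gaussian (goe_index n))" for w
      using that by (auto simp: space_PiM intro: PiE_arb)
    then show ?thesis
      unfolding gmat_def
      by (subst measurable_cong[where g = "\<lambda>_. (if p = q then sqrt 2 else 1) * undefined"]) simp_all
  qed
qed

lemma sets_gmat_closed:
  assumes "closed S"
  shows "{w \<in> space (std_gaussian (goe_index n)). gmat w \<in> S} \<in> sets (std_gaussian (goe_index n))"
proof -
  have "gmat -` S \<inter> space (std_gaussian (goe_index n)) \<in> sets (std_gaussian (goe_index n))"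
    by (rule measurable_sets[OF measurable_gmat]) (simp add: assms borel_closed)
  then show ?thesis by (simp add: vimage_def Int_def conj_commute)
qed

subsection \<open>Concentration for random signs\<close>

text \<open>Both sides are power series in x^2 and are compared term by term, using (2k)!
  \<open>\<ge>\<close> 2^k k!.\<close>

lemma exp_plus_exp_minus_le: "exp x + exp (- x) \<le> 2 * exp (x\<^sup>2 / 2)" for x :: real
proof -
  have fact: "2 ^ k * fact k \<le> (fact (2 * k) :: real)" for k
  proof (induction k)
    case (Suc k)
    have "2 ^ Suc k * fact (Suc k) = (2 * real (Suc k)) * (2 ^ k * fact k)" by simp
    also have "\<dots> \<le> (2 * real (Suc k)) * ((2 * real k + 1) * fact (2 * k))"
    proof (intro mult_left_mono)
      have "fact (2 * k) \<le> (2 * real k + 1) * fact (2 * k)" by (simp add: algebra_simps)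
      with Suc show "2 ^ k * fact k \<le> (2 * real k + 1) * fact (2 * k)" by (rule order_trans)
    qed simp
    also have "\<dots> = fact (Suc (Suc (2 * k)))" unfolding fact_Suc by simp
    also have "Suc (Suc (2 * k)) = 2 * Suc k" by simp
    finally show ?case .
  qed simp
  define f where "f m = (if even m then x ^ m /\<^sub>R fact m else 0)" for m
  have "f sums cosh x" unfolding f_def by (rule cosh_converges)
  then have "(\<lambda>k. f (2 * k)) sums cosh x"
  proof (rule iffD2[OF sums_mono_reindex, rotated 2])
    show "strict_mono (\<lambda>k::nat. 2 * k)" by (simp add: strict_mono_def)
    show "f m = 0" if "m \<notin> range (\<lambda>k. 2 * k)" for m
      using that by (auto simp: f_def dvd_def)
  qed
  moreover have "f (2 * k) = x ^ (2 * k) / fact (2 * k)" for k by (simp add: f_def field_simps)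
  ultimately have s1: "(\<lambda>k. x ^ (2 * k) / fact (2 * k)) sums cosh x" by (rule iffD1[OF sums_cong, rotated])
  have s2: "(\<lambda>k. (x\<^sup>2 / 2) ^ k / fact k) sums exp (x\<^sup>2 / 2)"
  proof -
    have "(\<lambda>k. (x\<^sup>2 / 2) ^ k / fact k) = (\<lambda>k. (x\<^sup>2 / 2) ^ k /\<^sub>R fact k)"
      by (rule ext) (simp add: field_simps)
    then show ?thesis by (rule ssubst) (rule exp_converges)
  qed
  have "x ^ (2 * k) / fact (2 * k) \<le> (x\<^sup>2 / 2) ^ k / fact k" for k
  proof -
    have "x ^ (2 * k) / fact (2 * k) \<le> x ^ (2 * k) / (2 ^ k * fact k)"
      using fact[of k] by (intro divide_left_mono) auto
    also have "\<dots> = (x\<^sup>2 / 2) ^ k / fact k" by (simp add: power_divide power_mult)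
    finally show ?thesis .
  qed
  then have "cosh x \<le> exp (x\<^sup>2 / 2)" by (rule sums_le[OF _ s1 s2])
  then show ?thesis by (simp add: cosh_def)
qed

text \<open>Extensional functions make the set finite and let a sum over it of a product over
  coordinates factorise.\<close>

definition sign_vectors :: "nat \<Rightarrow> (nat \<Rightarrow> real) set" where
  "sign_vectors n = PiE {..<n} (\<lambda>_. {-1, 1})"

lemma finite_sign_vectors: "finite (sign_vectors n)"
  by (simp add: sign_vectors_def finite_PiE)

lemma card_sign_vectors: "card (sign_vectors n) = 2 ^ n"
  by (simp add: sign_vectors_def card_PiE numeral_2_eq_2)

lemma dotp_sign_vector_self:
  assumes "e \<in> sign_vectors n"
  shows "dotp n e e = real n"
proof -
  have "e l * e l = 1" if "l < n" for l
  proof -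
    have "e l \<in> {-1, 1}" using assms that unfolding sign_vectors_def PiE_iff by blast
    then show ?thesis by auto
  qed
  then show ?thesis by (simp add: dotp_def)
qed

text \<open>Hubbard-Stratonovich: each exponential of a square is a Gaussian average of exponentials of
  linear forms, whose average over the signs factorises; orthonormality restores a sum of squares.\<close>

lemma sum_sign_vectors_exp_linear_le:
  assumes "finite S" and on: "orthonormal_family n S v"
  shows "(\<Sum>e\<in>sign_vectors n. exp (a * (\<Sum>i\<in>S. h i * dotp n (v i) e)))
    \<le> 2 ^ n * exp (a\<^sup>2 / 2 * (\<Sum>i\<in>S. (h i)\<^sup>2))"
proof -
  \<comment> \<open>Coefficient vector of the linear form; by orthonormality its square length is
    the sum of the squares of \<open>h\<close>, whatever the basis.\<close>
  define g where "g l = (\<Sum>i\<in>S. h i * v i l)" for l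
  have lin: "(\<Sum>i\<in>S. h i * dotp n (v i) e) = dotp n e g" for e
    unfolding g_def dotp_sum_right dotp_scale_right by (simp add: dotp_commute)
  have "dotp n x g = (\<Sum>i\<in>S. h i * dotp n x (v i))" for x
    unfolding g_def dotp_sum_right dotp_scale_right ..
  then have "dotp n g g = (\<Sum>i\<in>S. h i * dotp n g (v i))" .
  also have "\<dots> = (\<Sum>i\<in>S. (h i)\<^sup>2)"
  proof (rule sum.cong)
    fix i assume "i \<in> S"
    have "dotp n (v i) g = (\<Sum>j\<in>S. h j * dotp n (v i) (v j))"
      unfolding g_def dotp_sum_right dotp_scale_right ..
    also have "\<dots> = (\<Sum>j\<in>S. if i = j then h j else 0)"
      using on \<open>i \<in> S\<close> by (intro sum.cong) (auto simp: orthonormal_family_def)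
    finally have "dotp n g (v i) = h i" using \<open>finite S\<close> \<open>i \<in> S\<close> by (simp add: dotp_commute)
    then show "h i * dotp n g (v i) = (h i)\<^sup>2" by (simp add: power2_eq_square)
  qed simp
  finally have gg: "dotp n g g = (\<Sum>i\<in>S. (h i)\<^sup>2)" .
  have "(\<Sum>e\<in>sign_vectors n. exp (a * (\<Sum>i\<in>S. h i * dotp n (v i) e)))
    = (\<Sum>e\<in>sign_vectors n. \<Prod>l<n. exp (e l * (a * g l)))"
    unfolding lin by (simp add: dotp_def sum_distrib_left mult.left_commute flip: exp_sum)
  also have "\<dots> = (\<Prod>l<n. \<Sum>y\<in>{-1, 1}. exp (y * (a * g l)))"
    unfolding sign_vectors_def by (subst prod_sum_PiE) auto
  also have "\<dots> \<le> (\<Prod>l<n. 2 * exp ((a * g l)\<^sup>2 / 2))"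
    using exp_plus_exp_minus_le by (intro prod_mono) (auto simp: add.commute intro!: add_nonneg_nonneg)
  also have "\<dots> = 2 ^ n * exp (\<Sum>l<n. (a * g l)\<^sup>2 / 2)"
    by (simp add: prod.distrib exp_sum)
  also have "(\<Sum>l<n. (a * g l)\<^sup>2 / 2) = a\<^sup>2 / 2 * dotp n g g"
    by (simp add: dotp_def sum_distrib_left power2_eq_square ac_simps)
  finally show ?thesis by (simp add: gg)
qed

lemma sum_sign_vectors_exp_square_le:
  assumes "finite S" and on: "orthonormal_family n S v" and \<theta>: "0 \<le> \<theta>" "\<theta> < 1/2"
  shows "(\<Sum>e\<in>sign_vectors n. exp (\<theta> * (\<Sum>i\<in>S. (dotp n (v i) e)\<^sup>2)))
    \<le> 2 ^ n * (1 / sqrt (1 - 2 * \<theta>)) ^ card S"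
proof -
  interpret product_sigma_finite "\<lambda>_ :: nat. std_normal_distribution"
    by (rule product_sigma_finite_std_normal)
  \<comment> \<open>Chosen so that the Gaussian average of \<open>exp (a * x * y)\<close> over
    \<open>x\<close> is \<open>exp (\<theta> * y\<^sup>2)\<close>.\<close>
  define a where "a = sqrt (2 * \<theta>)"
  have a2: "a\<^sup>2 / 2 = \<theta>" using \<theta> by (simp add: a_def)
  have one: "ennreal (exp (\<theta> * (\<Sum>i\<in>S. (y i)\<^sup>2))) =
    (\<integral>\<^sup>+h. ennreal (exp (a * (\<Sum>i\<in>S. h i * y i))) \<partial>std_gaussian S)" for y :: "nat \<Rightarrow> real"
  proof -
    have "(\<integral>\<^sup>+h. ennreal (exp (a * (\<Sum>i\<in>S. h i * y i))) \<partial>std_gaussian S) =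
      (\<integral>\<^sup>+h. (\<Prod>i\<in>S. ennreal (exp ((a * y i) * h i))) \<partial>std_gaussian S)"
      by (subst prod_ennreal)
        (auto simp: sum_distrib_left ac_simps \<open>finite S\<close> exp_sum intro!: nn_integral_cong arg_cong[where f = ennreal])
    also have "\<dots> = (\<Prod>i\<in>S. \<integral>\<^sup>+x. ennreal (exp ((a * y i) * x)) \<partial>std_normal_distribution)"
      by (rule product_nn_integral_prod) (auto simp: \<open>finite S\<close>)
    also have "\<dots> = (\<Prod>i\<in>S. ennreal (exp ((a * y i)\<^sup>2 / 2)))"
      unfolding nn_integral_std_normal_exp_linear ..
    also have "\<dots> = ennreal (exp (\<Sum>i\<in>S. (a * y i)\<^sup>2 / 2))"
      by (subst prod_ennreal) (auto simp: exp_sum \<open>finite S\<close>)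
    also have "(\<Sum>i\<in>S. (a * y i)\<^sup>2 / 2) = \<theta> * (\<Sum>i\<in>S. (y i)\<^sup>2)"
      unfolding a2[symmetric] by (simp add: sum_distrib_left power_mult_distrib)
    finally show ?thesis ..
  qed
  have "ennreal (\<Sum>e\<in>sign_vectors n. exp (\<theta> * (\<Sum>i\<in>S. (dotp n (v i) e)\<^sup>2))) =
    (\<Sum>e\<in>sign_vectors n. \<integral>\<^sup>+h. ennreal (exp (a * (\<Sum>i\<in>S. h i * dotp n (v i) e))) \<partial>std_gaussian S)"
    by (subst sum_ennreal[symmetric]) (auto simp: one)
  also have "\<dots> = (\<integral>\<^sup>+h. (\<Sum>e\<in>sign_vectors n. ennreal (exp (a * (\<Sum>i\<in>S. h i * dotp n (v i) e)))) \<partial>std_gaussian S)"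
    by (rule nn_integral_sum[symmetric]) auto
  \<comment> \<open>After averaging over the signs, the integrand depends on \<open>h\<close>
    through its squares only, so what remains is a product of one-dimensional moments, as if the
    projections were independent normal variables.\<close>
  also have "\<dots> \<le> (\<integral>\<^sup>+h. ennreal (2 ^ n) * (\<Prod>i\<in>S. ennreal (exp (\<theta> * (h i)\<^sup>2))) \<partial>std_gaussian S)"
  proof (rule nn_integral_mono)
    fix h :: "nat \<Rightarrow> real"
    have "(\<Sum>e\<in>sign_vectors n. ennreal (exp (a * (\<Sum>i\<in>S. h i * dotp n (v i) e))))
      \<le> ennreal (2 ^ n * exp (\<theta> * (\<Sum>i\<in>S. (h i)\<^sup>2)))"
      using sum_sign_vectors_exp_linear_le[OF assms(1) on, of a h]
      by (subst sum_ennreal) (auto simp: a2 intro!: ennreal_leI)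
    also have "\<dots> = ennreal (2 ^ n) * (\<Prod>i\<in>S. ennreal (exp (\<theta> * (h i)\<^sup>2)))"
      by (subst prod_ennreal) (auto simp: sum_distrib_left exp_sum \<open>finite S\<close> ennreal_mult')
    finally show "(\<Sum>e\<in>sign_vectors n. ennreal (exp (a * (\<Sum>i\<in>S. h i * dotp n (v i) e))))
      \<le> ennreal (2 ^ n) * (\<Prod>i\<in>S. ennreal (exp (\<theta> * (h i)\<^sup>2)))" .
  qed
  also have "\<dots> = ennreal (2 ^ n) * (\<integral>\<^sup>+h. (\<Prod>i\<in>S. ennreal (exp (\<theta> * (h i)\<^sup>2))) \<partial>std_gaussian S)"
    by (rule nn_integral_cmult) measurable
  also have "(\<integral>\<^sup>+h. (\<Prod>i\<in>S. ennreal (exp (\<theta> * (h i)\<^sup>2))) \<partial>std_gaussian S) =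
      (\<Prod>i\<in>S. \<integral>\<^sup>+x. ennreal (exp (\<theta> * x\<^sup>2)) \<partial>std_normal_distribution)"
    by (rule product_nn_integral_prod) (auto simp: \<open>finite S\<close>)
  also have "\<dots> = ennreal ((1 / sqrt (1 - 2 * \<theta>)) ^ card S)"
    using \<theta> by (simp add: nn_integral_std_normal_exp_square ennreal_power)
  also have "ennreal (2 ^ n) * \<dots> = ennreal (2 ^ n * (1 / sqrt (1 - 2 * \<theta>)) ^ card S)"
    by (simp add: ennreal_mult')
  finally show ?thesis using \<theta> by (subst (asm) ennreal_le_iff) auto
qed

text \<open>Chernoff's method with the preceding moment bound, whose logarithm per dimension is
  estimated by a quadratic polynomial.\<close>

lemma card_sign_vectors_large_projection_le:
  assumes "finite S" and on: "orthonormal_family n S v" and \<theta>: "0 \<le> \<theta>" "\<theta> \<le> 1/4"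
  shows "real (card {e \<in> sign_vectors n. y \<le> (\<Sum>i\<in>S. (dotp n (v i) e)\<^sup>2)})
    \<le> 2 ^ n * exp (real (card S) * (\<theta> + 4 * \<theta>\<^sup>2) - \<theta> * y)" (is "real (card ?B) \<le> _")
proof -
  have "1 / sqrt (1 - 2 * \<theta>) \<le> exp (\<theta> + 4 * \<theta>\<^sup>2)"
  proof -
    \<comment> \<open>From ln (1 - x) \<open>\<ge>\<close> - x - 2 x^2 on [0, 1/2] at x = 2
      \<open>\<theta>\<close>; hence the restriction to \<open>\<theta> \<le> 1/4\<close>.\<close>
    have "- (2 * \<theta>) - 8 * \<theta>\<^sup>2 \<le> ln (1 - 2 * \<theta>)"
      using \<theta> ln_one_minus_pos_lower_bound[of "2 * \<theta>"] by simp
    then have "- (ln (1 - 2 * \<theta>) / 2) \<le> \<theta> + 4 * \<theta>\<^sup>2" by simp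
    moreover have "1 / sqrt (1 - 2 * \<theta>) = exp (- (ln (1 - 2 * \<theta>) / 2))"
      using \<theta> by (simp add: exp_minus ln_sqrt[symmetric] inverse_eq_divide)
    ultimately show ?thesis by simp
  qed
  then have pow: "(1 / sqrt (1 - 2 * \<theta>)) ^ card S \<le> exp (real (card S) * (\<theta> + 4 * \<theta>\<^sup>2))"
    using \<theta> by (subst exp_of_nat_mult) (intro power_mono, auto)
  have "real (card ?B) * exp (\<theta> * y) = (\<Sum>e\<in>?B. exp (\<theta> * y))" by simp
  also have "\<dots> \<le> (\<Sum>e\<in>?B. exp (\<theta> * (\<Sum>i\<in>S. (dotp n (v i) e)\<^sup>2)))"
    using \<theta> by (intro sum_mono) (auto intro: mult_left_mono)
  also have "\<dots> \<le> (\<Sum>e\<in>sign_vectors n. exp (\<theta> * (\<Sum>i\<in>S. (dotp n (v i) e)\<^sup>2)))"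
    by (intro sum_mono2 finite_sign_vectors) auto
  also have "\<dots> \<le> 2 ^ n * (1 / sqrt (1 - 2 * \<theta>)) ^ card S"
    using \<theta> by (intro sum_sign_vectors_exp_square_le assms) auto
  also have "\<dots> \<le> 2 ^ n * exp (real (card S) * (\<theta> + 4 * \<theta>\<^sup>2))" using pow by simp
  finally show ?thesis by (simp add: exp_diff field_simps)
qed

subsection \<open>Averaging over unit vectors\<close>

abbreviation goe_source :: "nat \<Rightarrow> (nat \<times> nat \<Rightarrow> real) measure" where
  "goe_source n \<equiv> std_gaussian (goe_index n)"

definition bad_event :: "nat \<Rightarrow> real \<Rightarrow> (nat \<Rightarrow> real) \<Rightarrow> (nat \<times> nat \<Rightarrow> real) set" where
  "bad_event n t u = {w \<in> space (goe_source n). gmat w \<in> bad_matrices n t u}"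

lemma sets_bad_event [measurable]: "bad_event n t u \<in> sets (goe_source n)"
  unfolding bad_event_def by (rule sets_gmat_closed[OF closed_bad_matrices])

text \<open>Rotating eigenvectors and \<open>u\<close> together leaves every inner product
  unchanged, so the measure-preserving map behind the conjugation sends the first event into the
  second.\<close>

lemma emeasure_bad_event_rotate_le:
  assumes ij: "i < n" "j < n" "i \<noteq> j" and cs: "c\<^sup>2 + s\<^sup>2 = 1"
  shows "emeasure (goe_source n) (bad_event n t u) \<le>
    emeasure (goe_source n) (bad_event n t (rotate_coords i j c s u))"
proof -
  let ?E = "bad_event n t (rotate_coords i j c s u)"
  obtain T where T: "preserves_measure (goe_source n) T"
    and gT: "\<And>w p q. p < n \<Longrightarrow> q < n \<Longrightarrow> gmat (T w) p q = conjugate i j c s (gmat w) p q"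
    using gmat_conjugation_invariant[OF ij cs] by metis
  have meas: "T \<in> measurable (goe_source n) (goe_source n)"
    and distr: "distr (goe_source n) (goe_source n) T = goe_source n"
    using T by (auto simp: preserves_measure_def)
  have sub: "bad_event n t u \<subseteq> T -` ?E \<inter> space (goe_source n)"
  proof
    fix w assume w: "w \<in> bad_event n t u"
    then obtain lam v where sd: "spectral_decomp n (gmat w) lam v" and t: "t \<le> \<bar>half_deviation n v u\<bar>"
      by (auto simp: bad_event_def bad_matrices_def)
    have "spectral_decomp n (gmat (T w)) lam (\<lambda>m. rotate_coords i j c s (v m))"
      by (rule spectral_decomp_conjugate[OF ij cs sd gT])
    moreover have "half_deviation n (\<lambda>m. rotate_coords i j c s (v m)) (rotate_coords i j c s u) = half_deviation n v u"
      unfolding half_deviation_def dotp_rotate_coords[OF ij cs] ..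
    ultimately have "gmat (T w) \<in> bad_matrices n t (rotate_coords i j c s u)"
      using t unfolding bad_matrices_def
      by (intro CollectI exI[of _ lam] exI[of _ "\<lambda>m. rotate_coords i j c s (v m)"]) simp
    then show "w \<in> T -` ?E \<inter> space (goe_source n)"
      using w measurable_space[OF meas] by (auto simp: bad_event_def)
  qed
  have "emeasure (goe_source n) (bad_event n t u) \<le> emeasure (goe_source n) (T -` ?E \<inter> space (goe_source n))"
    using sub by (rule emeasure_mono) (rule measurable_sets[OF meas sets_bad_event])
  also have "\<dots> = emeasure (distr (goe_source n) (goe_source n) T) ?E"
    by (rule emeasure_distr[symmetric, OF meas sets_bad_event])
  finally show ?thesis unfolding distr .
qed

definition unit_vector :: "nat \<Rightarrow> nat \<Rightarrow> real" where
  "unit_vector k l = (if l = k then 1 else 0)"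

lemma dotp_unit_vector_right: "k < n \<Longrightarrow> dotp n x (unit_vector k) = x k"
  using dotp_unit_vector[of k n x] unfolding unit_vector_def by (simp add: dotp_commute)

text \<open>Givens rotations: each one merges a nonzero coordinate \<open>j\<close> into coordinate
  \<open>k\<close>, so the number of other nonzero coordinates drops until \<open>u\<close> is the
  coordinate vector up to sign.\<close>

lemma emeasure_bad_event_unit_vector_le:
  assumes "k < n" "dotp n u u = 1"
  shows "emeasure (goe_source n) (bad_event n t (unit_vector k)) \<le> emeasure (goe_source n) (bad_event n t u)"
  using assms(2)
proof (induction "card {j. j < n \<and> j \<noteq> k \<and> u j \<noteq> 0}" arbitrary: u rule: less_induct)
  case less
  show ?case
  proof (cases "\<exists>j<n. j \<noteq> k \<and> u j \<noteq> 0")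
    case False
    then have u: "dotp n x u = u k * x k" for x
    proof -
      have "dotp n x u = dotp n x (\<lambda>l. u k * unit_vector k l)"
        using False by (intro dotp_cong) (auto simp: unit_vector_def)
      then show ?thesis using dotp_unit_vector_right[OF \<open>k < n\<close>] by (simp add: dotp_scale_right)
    qed
    \<comment> \<open>Here \<open>u\<close> is plus or minus the coordinate vector, and squaring
      removes the sign.\<close>
    then have "(u k)\<^sup>2 = 1" using less.prems by (simp add: power2_eq_square)
    then have "half_deviation n v u = half_deviation n v (unit_vector k)" for v
      unfolding half_deviation_def u dotp_unit_vector_right[OF \<open>k < n\<close>] by (simp add: power_mult_distrib)
    then show ?thesis by (simp add: bad_event_def bad_matrices_def)
  next
    case True
    then obtain j where j: "j < n" "j \<noteq> k" "u j \<noteq> 0" by blast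
    define r where "r = sqrt ((u k)\<^sup>2 + (u j)\<^sup>2)"
    have r: "r > 0" "r\<^sup>2 = (u k)\<^sup>2 + (u j)\<^sup>2"
      using j(3) by (auto simp: r_def add_nonneg_pos)
    \<comment> \<open>Rotating \<open>u'\<close> by the angle with cosine \<open>u k / r\<close> and
      sine \<open>u j / r\<close> gives back \<open>u\<close>.\<close>
    define u' where "u' = u(k := r, j := 0)"
    have cs: "(u k / r)\<^sup>2 + (u j / r)\<^sup>2 = 1"
      using r(1) by (simp add: power_divide add_divide_distrib[symmetric] flip: r(2))
    have rot: "rotate_coords k j (u k / r) (u j / r) u' = u"
      using r(1) j(2) by (auto simp: rotate_coords_def u'_def fun_eq_iff)
    have "dotp n u' u' = 1"
      using dotp_rotate_coords[OF \<open>k < n\<close> j(1) _ cs, of u' u'] j(2) less.prems rot by simp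
    moreover have "card {l. l < n \<and> l \<noteq> k \<and> u' l \<noteq> 0} < card {l. l < n \<and> l \<noteq> k \<and> u l \<noteq> 0}"
      by (rule psubset_card_mono) (use j in \<open>auto simp: u'_def\<close>)
    ultimately have "emeasure (goe_source n) (bad_event n t (unit_vector k)) \<le> emeasure (goe_source n) (bad_event n t u')"
      by (intro less.hyps)
    also have "\<dots> \<le> emeasure (goe_source n) (bad_event n t u)"
      using emeasure_bad_event_rotate_le[OF \<open>k < n\<close> j(1) _ cs, of t u'] j(2) unfolding rot by simp
    finally show ?thesis .
  qed
qed

section \<open>Almost sure simplicity of the spectrum\<close>

lemma null_set_std_gaussian_if_countable_slices:
  assumes "finite I" "a \<in> I" and S: "S \<in> sets (std_gaussian I)"
    and slices: "\<And>\<eta>. countable {x. \<eta>(a := x) \<in> S}"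
  shows "emeasure (std_gaussian I) S = 0"
proof -
  interpret product_sigma_finite "\<lambda>_. std_normal_distribution" by (rule product_sigma_finite_std_normal)
  define J where "J = I - {a}"
  have I: "I = insert a J" "finite J" "a \<notin> J" using assms by (auto simp: J_def)
  have "emeasure (std_gaussian I) S = (\<integral>\<^sup>+w. indicator S w \<partial>std_gaussian (insert a J))"
    using S I by simp
  also have "\<dots> = (\<integral>\<^sup>+\<eta>. \<integral>\<^sup>+x. indicator S (\<eta>(a := x)) \<partial>std_normal_distribution \<partial>std_gaussian J)"
    using S I by (intro product_nn_integral_insert) auto
  also have "\<dots> = (\<integral>\<^sup>+\<eta>. 0 \<partial>std_gaussian J)"
  proof (rule nn_integral_cong)
    fix \<eta> assume "\<eta> \<in> space (std_gaussian J)"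
    \<comment> \<open>The law of one coordinate has a Lebesgue density, so countable slices are null
      and Fubini applies.\<close>
    have "AE x in lborel. x \<notin> {x. \<eta>(a := x) \<in> S}"
      by (rule AE_not_in[OF countable_imp_null_set_lborel[OF slices]])
    then have "AE x in std_normal_distribution. indicator S (\<eta>(a := x)) = (0::ennreal)"
      by (subst AE_density) auto
    from nn_integral_cong_AE[OF this]
    show "(\<integral>\<^sup>+x. indicator S (\<eta>(a := x)) \<partial>std_normal_distribution) = (0::ennreal)" by simp
  qed
  finally show ?thesis by simp
qed

lemma eigenvector_of_cong:
  assumes "\<And>p q. p < n \<Longrightarrow> q < n \<Longrightarrow> A p q = B p q"
  shows "eigenvector_of n A \<mu> w \<longleftrightarrow> eigenvector_of n B \<mu> w"
proof -
  have "dotp n (A p) w = dotp n (B p) w" if "p < n" for p using assms that by (intro dotp_cong) auto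
  then show ?thesis by (simp add: eigenvector_of_def)
qed

lemma double_eigenvalue_cong:
  assumes "\<And>p q. p < n \<Longrightarrow> q < n \<Longrightarrow> A p q = B p q"
  shows "double_eigenvalue n A \<longleftrightarrow> double_eigenvalue n B"
  unfolding double_eigenvalue_def using eigenvector_of_cong[of n A B, OF assms] by simp

text \<open>Each eigenvalue of the block determines its eigenvector up to sign, hence the entry that makes
  the last row orthogonal to it.\<close>

lemma countable_row_orthogonal_slice:
  assumes "i < m"
  shows "countable {x. \<not> double_eigenvalue m (gmat (\<eta>(upair i m := x))) \<and>
    row_orthogonal_eigenvector m i (gmat (\<eta>(upair i m := x)))}" (is "countable ?X")
proof -
  let ?A = "\<lambda>x. gmat (\<eta>(upair i m := x))"
  let ?M = "gmat \<eta>"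
  let ?R = "\<lambda>z. \<Sum>j\<in>{..<m} - {i}. gmat \<eta> m j * z j"
  \<comment> \<open>Entry (i, m) lies outside the leading block, so the block and its eigenvectors
    stay fixed as \<open>x\<close> varies; only the linear equation in \<open>row\<close>
    moves.\<close>
  have block: "?A x p q = ?M p q" if "p < m" "q < m" for x p q
    using that by (auto simp: gmat_def upair_eq_iff)
  have row: "dotp m (?A x m) z = x * z i + ?R z" for x z
  proof -
    have "dotp m (?A x m) z = ?A x m i * z i + (\<Sum>j\<in>{..<m} - {i}. ?A x m j * z j)"
      unfolding dotp_def using assms by (intro sum.remove) auto
    also have "?A x m i = x" using assms by (simp add: gmat_def upair_commute)
    also have "(\<Sum>j\<in>{..<m} - {i}. ?A x m j * z j) = ?R z"
      using assms by (intro sum.cong) (auto simp: gmat_def upair_eq_iff)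
    finally show ?thesis .
  qed
  have ex: "\<exists>\<mu> z. dotp m z z = 1 \<and> eigenvector_of m ?M \<mu> z \<and> x * z i + ?R z = 0 \<and> z i \<noteq> 0" if x: "x \<in> ?X" for x
  proof -
    obtain z \<mu> where z: "dotp m z z = 1" "eigenvector_of m (?A x) \<mu> z" "dotp m (?A x m) z = 0" "1 \<le> real m * (z i)\<^sup>2"
      using x unfolding row_orthogonal_eigenvector_def by blast
    have "eigenvector_of m ?M \<mu> z" using z(2) eigenvector_of_cong[of m "?A x" ?M, OF block] by blast
    moreover have "z i \<noteq> 0" using z(4) by auto
    ultimately show ?thesis using z(1,3) row by metis
  qed
  from bchoice[OF ballI[OF ex]] obtain f where
    "\<forall>x\<in>?X. \<exists>z. dotp m z z = 1 \<and> eigenvector_of m ?M (f x) z \<and> x * z i + ?R z = 0 \<and> z i \<noteq> 0" ..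
  from bchoice[OF this] obtain g where g:
    "\<forall>x\<in>?X. dotp m (g x) (g x) = 1 \<and> eigenvector_of m ?M (f x) (g x) \<and> x * g x i + ?R (g x) = 0 \<and> g x i \<noteq> 0" ..
  note fg = bspec[OF g]
  have "inj_on f ?X"
  proof (rule inj_onI)
    fix x y assume xy: "x \<in> ?X" "y \<in> ?X" and f: "f x = f y"
    have "\<not> double_eigenvalue m ?M" using xy(1) double_eigenvalue_cong[of m "?A x" ?M, OF block] by blast
    then obtain c where c: "c\<^sup>2 = 1" "\<And>l. l < m \<Longrightarrow> g y l = c * g x l"
      by (rule simple_eigenvector_unique[of m ?M "g x" "f x" "g y"])
        (use fg[OF xy(1)] fg[OF xy(2)] f in auto)
    have "?R (g y) = c * ?R (g x)"
      unfolding sum_distrib_left using c(2) by (intro sum.cong) auto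
    then have "c * (y * g x i + ?R (g x)) = 0"
      using fg[OF xy(2)] c(2)[OF assms] by (simp add: algebra_simps)
    moreover have "c \<noteq> 0" using c(1) by auto
    ultimately have "y * g x i + ?R (g x) = 0" by simp
    moreover have "x * g x i + ?R (g x) = 0" using fg[OF xy(1)] by blast
    ultimately have "y * g x i = x * g x i" by linarith
    then show "x = y" using fg[OF xy(1)] by simp
  qed
  moreover have "finite (f ` ?X)"
  proof (rule finite_subset[OF _ finite_eigenvalues[of m ?M]])
    show "f ` ?X \<subseteq> {\<mu>. \<exists>w. dotp m w w = 1 \<and> eigenvector_of m ?M \<mu> w}"
      using fg by blast
  qed (rule gmat_symmetric)
  ultimately have "finite ?X" by (rule finite_imageD[rotated])
  then show ?thesis by (rule countable_finite)
qed

text \<open>The event is a difference of two closed events, hence measurable. Simplicity of the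
  minor belongs to it because the slice bound relies on it; the induction on the size of the minor
  supplies that part.\<close>

lemma AE_not_row_orthogonal:
  assumes "i < m" "m < n"
  shows "AE w in goe_source n. \<not> (\<not> double_eigenvalue m (gmat w) \<and> row_orthogonal_eigenvector m i (gmat w))"
proof -
  let ?S = "{w \<in> space (goe_source n). \<not> double_eigenvalue m (gmat w) \<and> row_orthogonal_eigenvector m i (gmat w)}"
  have "?S = {w \<in> space (goe_source n). gmat w \<in> {A. row_orthogonal_eigenvector m i A}} -
      {w \<in> space (goe_source n). gmat w \<in> {A. double_eigenvalue m A}}" by auto
  also have "\<dots> \<in> sets (goe_source n)"
    by (intro sets.Diff sets_gmat_closed closed_double_eigenvalue closed_row_orthogonal_eigenvector assms)
  finally have S: "?S \<in> sets (goe_source n)" .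
  have "emeasure (goe_source n) ?S = 0"
  proof (rule null_set_std_gaussian_if_countable_slices[OF finite_goe_index _ S])
    show "upair i m \<in> goe_index n" using assms by (simp add: upair_in_goe_index)
    show "countable {x. \<eta>(upair i m := x) \<in> ?S}" for \<eta>
      by (rule countable_subset[OF _ countable_row_orthogonal_slice[OF assms(1), of \<eta>]]) auto
  qed
  then have "?S \<in> null_sets (goe_source n)" using S by auto
  from AE_not_in[OF this] show ?thesis by (rule AE_mp) (rule AE_I2, auto)
qed

lemma AE_not_double_eigenvalue:
  assumes "m \<le> n"
  shows "AE w in goe_source n. \<not> double_eigenvalue m (gmat w)"
  using assms
proof (induction m)
  case 0
  show ?case by (simp add: double_eigenvalue_def dotp_def)
next
  case (Suc m)
  then have IH: "AE w in goe_source n. \<not> double_eigenvalue m (gmat w)" by simp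
  have "AE w in goe_source n. \<forall>i\<in>{..<m}. \<not> (\<not> double_eigenvalue m (gmat w) \<and> row_orthogonal_eigenvector m i (gmat w))"
    using Suc.prems by (intro AE_finite_allI AE_not_row_orthogonal) auto
  with IH show ?case
  proof eventually_elim
    case (elim w)
    show ?case
    proof
      assume "double_eigenvalue (Suc m) (gmat w)"
      then obtain z \<mu> where z: "dotp m z z = 1" "eigenvector_of m (gmat w) \<mu> z" "dotp m (gmat w m) z = 0"
        by (rule double_eigenvalue_Suc_imp)
      \<comment> \<open>Pigeonhole: the squares sum to 1 over \<open>m\<close> coordinates, so one
        is at least 1/m. This reduces the claim to finitely many null events.\<close>
      have "\<exists>i<m. 1 \<le> real m * (z i)\<^sup>2"
      proof (rule ccontr)
        assume no: "\<not> (\<exists>i<m. 1 \<le> real m * (z i)\<^sup>2)"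
        have "m \<noteq> 0" using z(1) by (cases "m = 0") (auto simp: dotp_def)
        then have "(\<Sum>i<m. real m * (z i)\<^sup>2) < (\<Sum>i<m. 1)"
          using no by (intro sum_strict_mono) (auto simp: not_le lessThan_empty_iff)
        also have "(\<Sum>i<m. real m * (z i)\<^sup>2) = real m * dotp m z z"
          by (simp add: dotp_def sum_distrib_left power2_eq_square)
        finally show False using z(1) by simp
      qed
      then obtain i where "i < m" "1 \<le> real m * (z i)\<^sup>2" by blast
      then have "row_orthogonal_eigenvector m i (gmat w)"
        using z unfolding row_orthogonal_eigenvector_def by blast
      then show False using elim \<open>i < m\<close> by blast
    qed
  qed
qed

section \<open>From a fixed orthonormal basis to the random one\<close>

lemma half_deviation_unique:
  assumes "\<not> double_eigenvalue n A" "spectral_decomp n A lam v" "spectral_decomp n A lam' v'"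
  shows "half_deviation n v' u = half_deviation n v u"
  unfolding half_deviation_def
  using spectral_decomp_dotp_square_unique[OF assms] by (intro sum.cong) auto

text \<open>2^n times the probability is at most the expected number of bad sign vectors. Almost
  surely all of them are bad for one and the same basis, to which \<open>conc\<close>
  applies.\<close>

lemma emeasure_bad_event_le:
  assumes "k < n" "0 \<le> b"
    and conc: "\<And>v. orthonormal_family n {..<n} v \<Longrightarrow>
      real (card {e \<in> sign_vectors n. t \<le> \<bar>half_deviation n v (\<lambda>l. e l / sqrt (real n))\<bar>}) \<le> 2 ^ n * b"
  shows "emeasure (goe_source n) (bad_event n t (unit_vector k)) \<le> ennreal b"
proof -
  let ?G = "goe_source n"
  interpret prob_space ?G by (rule prob_space_std_gaussian)
  let ?u = "\<lambda>e l. e l / sqrt (real n)"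
  have n: "n > 0" using assms(1) by simp
  have unit: "dotp n (?u e) (?u e) = 1" if "e \<in> sign_vectors n" for e
  proof -
    have "dotp n (?u e) (?u e) = dotp n e e / real n"
      by (simp add: dotp_def sum_divide_distrib)
    then show ?thesis using dotp_sign_vector_self[OF that] n by simp
  qed
  have "ennreal (2 ^ n) * emeasure ?G (bad_event n t (unit_vector k)) =
    (\<Sum>e\<in>sign_vectors n. emeasure ?G (bad_event n t (unit_vector k)))"
    by (simp add: card_sign_vectors ennreal_power[symmetric])
  also have "\<dots> \<le> (\<Sum>e\<in>sign_vectors n. emeasure ?G (bad_event n t (?u e)))"
    by (intro sum_mono emeasure_bad_event_unit_vector_le assms unit)
  also have "\<dots> = (\<Sum>e\<in>sign_vectors n. \<integral>\<^sup>+w. indicator (bad_event n t (?u e)) w \<partial>?G)"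
    by simp
  also have "\<dots> = (\<integral>\<^sup>+w. (\<Sum>e\<in>sign_vectors n. indicator (bad_event n t (?u e)) w) \<partial>?G)"
    by (rule nn_integral_sum[symmetric]) measurable
  also have "\<dots> \<le> (\<integral>\<^sup>+w. ennreal (2 ^ n * b) \<partial>?G)"
  proof (rule nn_integral_mono_AE)
    show "AE w in ?G. (\<Sum>e\<in>sign_vectors n. indicator (bad_event n t (?u e)) w) \<le> ennreal (2 ^ n * b)"
      using AE_not_double_eigenvalue[of n n, OF order_refl]
    proof eventually_elim
      case (elim w)
      let ?B = "{e \<in> sign_vectors n. w \<in> bad_event n t (?u e)}"
      have "(\<Sum>e\<in>sign_vectors n. indicator (bad_event n t (?u e)) w) = ennreal (real (card ?B))"
        by (simp add: indicator_def sum.If_cases finite_sign_vectors Int_def ennreal_of_nat_eq_real_of_nat)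
      also have "\<dots> \<le> ennreal (2 ^ n * b)"
      proof (cases "\<exists>lam v. spectral_decomp n (gmat w) lam v")
        case True
        then obtain lam v where sd: "spectral_decomp n (gmat w) lam v" by blast
        have "?B \<subseteq> {e \<in> sign_vectors n. t \<le> \<bar>half_deviation n v (?u e)\<bar>}"
          using half_deviation_unique[OF elim sd] by (auto simp: bad_event_def bad_matrices_def)
        then have "card ?B \<le> card {e \<in> sign_vectors n. t \<le> \<bar>half_deviation n v (?u e)\<bar>}"
          by (intro card_mono) (auto simp: finite_sign_vectors)
        then show ?thesis
          using conc[OF spectral_decomp_orthonormal[OF sd]] by (intro ennreal_leI) linarith
      next
        case False
        then have B: "?B = {}" by (auto simp: bad_event_def bad_matrices_def)
        show ?thesis unfolding B by simp
      qed
      finally show ?case .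
    qed
  qed
  also have "\<dots> = ennreal (2 ^ n) * ennreal b"
    using assms(2) by (simp add: emeasure_space_1 ennreal_mult')
  finally have "ennreal (2 ^ n) * emeasure ?G (bad_event n t (unit_vector k)) \<le> ennreal (2 ^ n) * ennreal b" .
  moreover have "ennreal (2 ^ n) \<noteq> 0"
    by (metis ennreal_eq_0_iff not_le zero_less_numeral zero_less_power)
  ultimately show ?thesis using ennreal_mult_le_mult_iff[OF _ ennreal_neq_top] by metis
qed

text \<open>By Parseval the sums of squares over the two halves add up to \<open>n\<close>. A
  difference of at least \<open>\<tau> * n\<close> therefore lifts one half above its mean n/2 by
  the factor 1 + \<open>\<tau>\<close>, and the upper tail bound for each half concludes.\<close>

lemma half_deviation_sign_vectors_le:
  assumes "even n" and on: "orthonormal_family n {..<n} v" and \<tau>: "0 \<le> \<tau>" "\<tau> \<le> 1"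
  shows "real (card {e \<in> sign_vectors n. \<tau> \<le> \<bar>half_deviation n v (\<lambda>l. e l / sqrt (real n))\<bar>})
    \<le> 2 ^ n * (2 * exp (- (\<tau>\<^sup>2 * real n / 32)))"
proof (cases "n = 0")
  case True
  have "real (card {e \<in> sign_vectors 0. \<tau> \<le> \<bar>half_deviation 0 v (\<lambda>l. e l / sqrt (real 0))\<bar>}) \<le> real (card (sign_vectors 0))"
    by (intro of_nat_mono card_mono finite_sign_vectors) auto
  then show ?thesis using True by (simp add: card_sign_vectors)
next
  case False
  define r where "r = n div 2"
  have n: "real n = 2 * real r" "n = r + r" using assms(1) by (auto simp: r_def elim!: evenE)
  define Q where "Q S e = (\<Sum>i\<in>S. (dotp n (v i) e)\<^sup>2)" for S e
  let ?y = "real r + \<tau> * real r"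
  let ?B = "\<lambda>S. {e \<in> sign_vectors n. ?y \<le> Q S e}"
  have tail: "real (card (?B S)) \<le> 2 ^ n * exp (- (\<tau>\<^sup>2 * real n / 32))" if "S \<subseteq> {..<n}" "card S = r" for S
  proof -
    have "finite S" using that(1) finite_subset by blast
    moreover have "orthonormal_family n S v" using on that(1) unfolding orthonormal_family_def by blast
    \<comment> \<open>The parameter \<open>\<tau> / 8\<close> minimises the exponent 4
      \<open>\<theta>\<close>^2 - \<open>\<theta> \<tau>\<close> per dimension.\<close>
    ultimately have "real (card (?B S)) \<le> 2 ^ n * exp (real r * (\<tau> / 8 + 4 * (\<tau> / 8)\<^sup>2) - \<tau> / 8 * ?y)"
      unfolding Q_def that(2)[symmetric] using \<tau> by (intro card_sign_vectors_large_projection_le) auto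
    also have "real r * (\<tau> / 8 + 4 * (\<tau> / 8)\<^sup>2) - \<tau> / 8 * ?y = - (\<tau>\<^sup>2 * real n / 32)"
      unfolding n(1) by (simp add: power2_eq_square field_simps)
    finally show ?thesis .
  qed
  have sub: "{e \<in> sign_vectors n. \<tau> \<le> \<bar>half_deviation n v (\<lambda>l. e l / sqrt (real n))\<bar>} \<subseteq> ?B {..<r} \<union> ?B {r..<n}"
  proof
    fix e assume "e \<in> {e \<in> sign_vectors n. \<tau> \<le> \<bar>half_deviation n v (\<lambda>l. e l / sqrt (real n))\<bar>}"
    then have e: "e \<in> sign_vectors n" and t: "\<tau> \<le> \<bar>half_deviation n v (\<lambda>l. e l / sqrt (real n))\<bar>" by auto
    have split: "(\<Sum>i<n. f i) = (\<Sum>i<r. f i) + (\<Sum>i=r..<n. f i)" for f :: "nat \<Rightarrow> real"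
      using n(2) by (metis le_add1 lessThan_atLeast0 sum.atLeastLessThan_concat zero_le)
    have "half_deviation n v (\<lambda>l. e l / sqrt (real n)) = (\<Sum>i<n. sgn_half n i * (dotp n (v i) e)\<^sup>2 / real n)"
      unfolding half_deviation_def
    proof (rule sum.cong)
      fix i
      have "dotp n (v i) (\<lambda>l. e l / sqrt (real n)) = dotp n (v i) e / sqrt (real n)"
        by (simp add: dotp_def sum_divide_distrib)
      then show "sgn_half n i * (dotp n (v i) (\<lambda>l. e l / sqrt (real n)))\<^sup>2 = sgn_half n i * (dotp n (v i) e)\<^sup>2 / real n"
        by (simp add: power_divide)
    qed simp
    also have "\<dots> = (\<Sum>i<n. sgn_half n i * (dotp n (v i) e)\<^sup>2) / real n"
      by (simp add: sum_divide_distrib)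
    also have "(\<Sum>i<n. sgn_half n i * (dotp n (v i) e)\<^sup>2) = Q {..<r} e - Q {r..<n} e"
      unfolding split Q_def by (simp add: sgn_half_def r_def sum_negf)
    finally have hd: "half_deviation n v (\<lambda>l. e l / sqrt (real n)) = (Q {..<r} e - Q {r..<n} e) / real n" .
    have "\<tau> * real n \<le> \<bar>Q {..<r} e - Q {r..<n} e\<bar>"
      using t False unfolding hd by (simp add: abs_divide pos_le_divide_eq)
    moreover have "Q {..<r} e + Q {r..<n} e = real n"
    proof -
      have "Q {..<r} e + Q {r..<n} e = (\<Sum>i<n. (dotp n (v i) e)\<^sup>2)"
        unfolding Q_def by (rule split[symmetric])
      also have "\<dots> = (\<Sum>i<n. (dotp n e (v i))\<^sup>2)" by (simp only: dotp_commute[of n e])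
      also have "\<dots> = real n" unfolding parseval[OF on] by (rule dotp_sign_vector_self[OF e])
      finally show ?thesis .
    qed
    ultimately have "?y \<le> Q {..<r} e \<or> ?y \<le> Q {r..<n} e"
      unfolding n(1) by (auto simp: abs_if split: if_splits)
    then show "e \<in> ?B {..<r} \<union> ?B {r..<n}" using e by blast
  qed
  have "real (card {e \<in> sign_vectors n. \<tau> \<le> \<bar>half_deviation n v (\<lambda>l. e l / sqrt (real n))\<bar>})
    \<le> real (card (?B {..<r} \<union> ?B {r..<n}))"
    using sub by (intro of_nat_mono card_mono) (auto simp: finite_sign_vectors)
  also have "\<dots> \<le> real (card (?B {..<r}) + card (?B {r..<n}))"
    by (intro of_nat_mono card_Un_le)
  also have "\<dots> \<le> 2 ^ n * (2 * exp (- (\<tau>\<^sup>2 * real n / 32)))"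
  proof -
    have "{..<r} \<subseteq> {..<n}" "card {..<r} = r" "{r..<n} \<subseteq> {..<n}" "card {r..<n} = r"
      using n(2) by auto
    then show ?thesis using tail[of "{..<r}"] tail[of "{r..<n}"] by simp
  qed
  finally show ?thesis .
qed

subsection \<open>The diagonal of Z\<close>

definition entry_sd :: "nat \<times> nat \<Rightarrow> real" where
  "entry_sd a = (if fst a = snd a then sqrt 2 else 1)"

text \<open>Restriction to the index set keeps the result extensional, as points of the target
  product space must be.\<close>

definition normalize_entries :: "nat \<Rightarrow> (nat \<times> nat \<Rightarrow> real) \<Rightarrow> nat \<times> nat \<Rightarrow> real" where
  "normalize_entries n w = (\<lambda>a\<in>goe_index n. w a / entry_sd a)"

lemma entry_sd_pos: "0 < entry_sd a"
  by (simp add: entry_sd_def)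

lemma GOE_eq: "GOE n = PiM (goe_index n) (\<lambda>a. density lborel (normal_density 0 (entry_sd a)))"
  unfolding GOE_def by (intro PiM_cong refl) (auto simp: entry_sd_def)

lemma emeasure_normal_rescale:
  assumes "0 < \<sigma>" "A \<in> sets borel"
  shows "emeasure (density lborel (normal_density 0 \<sigma>)) ((\<lambda>x. x / \<sigma>) -` A) = emeasure std_normal_distribution A"
proof -
  let ?M = "density lborel (normal_density 0 \<sigma>)"
  interpret prob_space ?M by (rule prob_space_normal_density) fact
  have "distributed ?M lborel (\<lambda>x. x) (normal_density 0 \<sigma>)"
    unfolding distributed_def by (simp add: distr_id2)
  then have "distr ?M lborel (\<lambda>x. x / \<sigma>) = std_normal_distribution"
    using normal_standard_normal_convert[OF assms(1), of "\<lambda>x. x" 0]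
    by (simp add: distributed_distr_eq_density)
  then have "emeasure std_normal_distribution A = emeasure (distr ?M lborel (\<lambda>x. x / \<sigma>)) A" by simp
  also have "\<dots> = emeasure ?M ((\<lambda>x. x / \<sigma>) -` A \<inter> space ?M)"
    using assms(2) by (intro emeasure_distr) auto
  finally show ?thesis by simp
qed

lemma measurable_normalize_entries: "normalize_entries n \<in> measurable (GOE n) (goe_source n)"
  unfolding normalize_entries_def GOE_eq
proof (rule measurable_restrict)
  fix a assume a: "a \<in> goe_index n"
  have "(\<lambda>w. w a) \<in> measurable (PiM (goe_index n) (\<lambda>a. density lborel (normal_density 0 (entry_sd a))))
      (density lborel (normal_density 0 (entry_sd a)))"
    using a by (rule measurable_component_singleton)
  then have [measurable]: "(\<lambda>w. w a) \<in> borel_measurable (PiM (goe_index n) (\<lambda>a. density lborel (normal_density 0 (entry_sd a))))"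
    by simp
  show "(\<lambda>w. w a / entry_sd a) \<in> measurable (PiM (goe_index n) (\<lambda>a. density lborel (normal_density 0 (entry_sd a))))
      std_normal_distribution" by simp
qed

lemma distr_normalize_entries: "distr (GOE n) (goe_source n) (normalize_entries n) = goe_source n"
proof (rule product_sigma_finite.PiM_eqI[OF product_sigma_finite_std_normal finite_goe_index])
  let ?N = "\<lambda>a. density lborel (normal_density 0 (entry_sd a))"
  interpret product_sigma_finite ?N
    by (simp add: product_sigma_finite_def prob_space_imp_sigma_finite prob_space_normal_density entry_sd_pos)
  show "sets (distr (GOE n) (goe_source n) (normalize_entries n)) = sets (goe_source n)" by simp
  fix A :: "nat \<times> nat \<Rightarrow> real set" assume "\<And>a. a \<in> goe_index n \<Longrightarrow> A a \<in> sets std_normal_distribution"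
  then have A: "\<And>a. a \<in> goe_index n \<Longrightarrow> A a \<in> sets borel" by simp
  have "emeasure (distr (GOE n) (goe_source n) (normalize_entries n)) (PiE (goe_index n) A) =
    emeasure (GOE n) (normalize_entries n -` PiE (goe_index n) A \<inter> space (GOE n))"
    using A by (intro emeasure_distr measurable_normalize_entries sets_PiM_I_finite finite_goe_index) auto
  also have "normalize_entries n -` PiE (goe_index n) A \<inter> space (GOE n) =
      PiE (goe_index n) (\<lambda>a. (\<lambda>x. x / entry_sd a) -` A a)"
    by (auto simp: GOE_eq space_PiM normalize_entries_def PiE_iff)
  also have "emeasure (GOE n) \<dots> = (\<Prod>a\<in>goe_index n. emeasure (?N a) ((\<lambda>x. x / entry_sd a) -` A a))"
    unfolding GOE_eq
  proof (rule emeasure_PiM[OF finite_goe_index])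
    fix a assume "a \<in> goe_index n"
    have "(\<lambda>x. x / entry_sd a) -` A a \<inter> space borel \<in> sets borel"
      by (rule measurable_sets[of _ borel borel]) (use A \<open>a \<in> goe_index n\<close> in auto)
    then show "(\<lambda>x. x / entry_sd a) -` A a \<in> sets (?N a)" by simp
  qed
  also have "\<dots> = (\<Prod>a\<in>goe_index n. emeasure std_normal_distribution (A a))"
    using A by (intro prod.cong emeasure_normal_rescale entry_sd_pos) auto
  finally show "emeasure (distr (GOE n) (goe_source n) (normalize_entries n)) (PiE (goe_index n) A) =
    (\<Prod>a\<in>goe_index n. emeasure std_normal_distribution (A a))" .
qed

lemma gmat_normalize_entries:
  assumes "p < n" "q < n"
  shows "gmat (normalize_entries n w) p q = goe_mat w p q"
proof -
  have "upair p q \<in> goe_index n" using assms by (simp add: upair_in_goe_index)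
  then show ?thesis
    by (auto simp: gmat_def normalize_entries_def goe_mat_def entry_sd_def upair_def min_def max_def)
qed

lemma spectral_decomp_cong:
  assumes "\<And>p q. p < n \<Longrightarrow> q < n \<Longrightarrow> A p q = B p q"
  shows "spectral_decomp n A lam v \<longleftrightarrow> spectral_decomp n B lam v"
  using assms by (simp add: spectral_decomp_def)

lemma std_normal_tail_le:
  assumes "0 \<le> x"
  shows "emeasure std_normal_distribution {h. x \<le> \<bar>sqrt 2 * h\<bar>} \<le> ennreal (sqrt 2 * exp (- (x\<^sup>2 / 8)))"
proof -
  let ?T = "{h :: real. x \<le> \<bar>sqrt 2 * h\<bar>}"
  have [measurable]: "?T \<in> sets std_normal_distribution" by simp
  have "emeasure std_normal_distribution ?T = (\<integral>\<^sup>+h. indicator ?T h \<partial>std_normal_distribution)" by simp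
  \<comment> \<open>Exponential Markov inequality with parameter 1/4: on the event h^2
    \<open>\<ge>\<close> x^2 / 2, so the product of exponentials is at least 1. The moment equals
    sqrt 2.\<close>
  also have "\<dots> \<le> (\<integral>\<^sup>+h. ennreal (exp (- (x\<^sup>2 / 8))) * ennreal (exp (1/4 * h\<^sup>2)) \<partial>std_normal_distribution)"
  proof (rule nn_integral_mono)
    fix h :: real
    show "indicator ?T h \<le> ennreal (exp (- (x\<^sup>2 / 8))) * ennreal (exp (1/4 * h\<^sup>2))"
    proof (cases "h \<in> ?T")
      case True
      then have "x\<^sup>2 \<le> \<bar>sqrt 2 * h\<bar>\<^sup>2" using assms by (intro power_mono) auto
      then have "0 \<le> - (x\<^sup>2 / 8) + 1/4 * h\<^sup>2" by (simp add: power_mult_distrib)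
      then have "1 \<le> exp (- (x\<^sup>2 / 8) + 1/4 * h\<^sup>2)" by simp
      then have "1 \<le> exp (- (x\<^sup>2 / 8)) * exp (1/4 * h\<^sup>2)" by (simp only: exp_add)
      then have "ennreal 1 \<le> ennreal (exp (- (x\<^sup>2 / 8)) * exp (1/4 * h\<^sup>2))" by (rule ennreal_leI)
      then show ?thesis using True by (simp add: ennreal_mult')
    qed simp
  qed
  also have "\<dots> = ennreal (exp (- (x\<^sup>2 / 8))) * (\<integral>\<^sup>+h. ennreal (exp (1/4 * h\<^sup>2)) \<partial>std_normal_distribution)"
    by (rule nn_integral_cmult) measurable
  also have "(\<integral>\<^sup>+h. ennreal (exp (1/4 * h\<^sup>2)) \<partial>std_normal_distribution) = ennreal (sqrt 2)"
    by (subst nn_integral_std_normal_exp_square) (auto simp: real_sqrt_divide)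
  also have "ennreal (exp (- (x\<^sup>2 / 8))) * ennreal (sqrt 2) = ennreal (sqrt 2 * exp (- (x\<^sup>2 / 8)))"
    by (simp add: mult.commute flip: ennreal_mult')
  finally show ?thesis .
qed

lemma Zmat_diagonal:
  assumes "k < n" "spectral_decomp n A lam v"
  shows "Zmat n lam v k k = 3 * pi / 8 * sqrt (real n) * half_deviation n v (unit_vector k) - A k k"
proof -
  have "A k k = (\<Sum>i<n. lam i * v i k * v i k)" using assms by (simp add: spectral_decomp_def)
  then show ?thesis
    unfolding Zmat_def half_deviation_def dotp_unit_vector_right[OF assms(1)]
    by (simp add: sum_subtractf sum_distrib_left power2_eq_square algebra_simps)
qed

text \<open>The cover \<open>E\<close> is the preimage of two events on standard normal entries, a
  large signed sum and a large diagonal entry.\<close>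

lemma GOE_deviation_bound:
  assumes "even n" "k < n"
  shows "\<exists>E \<in> sets (GOE n).
    {w \<in> space (GOE n). \<exists>lam v. spectral_decomp n (goe_mat w) lam v \<and>
       \<bar>Zmat n lam v k k\<bar> \<ge> real n powr (1/6)} \<subseteq> E \<and>
    measure (GOE n) E \<le> 4 * exp (- (real n powr (1/3) / 288))"
proof -
  let ?G = "goe_source n"
  \<comment> \<open>Half of n^(1/6) is granted to the diagonal entry (\<open>x\<close>). The other
    half, divided by sqrt n and by 3 pi / 8 \<open>\<le>\<close> 3/2, leaves n^(-1/3) / 3 for the
    signed sum.\<close>
  define \<tau> where "\<tau> = real n powr (-1/3) / 3"
  define x where "x = real n powr (1/6) / 2"
  have n: "real n \<ge> 1" using assms(2) by simp
  have \<tau>: "0 \<le> \<tau>" "\<tau> \<le> 1"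
    using n powr_mono[of "-1/3" 0 "real n"] by (auto simp: \<tau>_def)
  define D where "D = {w \<in> space ?G. w (k, k) \<in> {h. x \<le> \<bar>sqrt 2 * h\<bar>}}"
  define F where "F = bad_event n \<tau> (unit_vector k) \<union> D"
  define E where "E = normalize_entries n -` F \<inter> space (GOE n)"
  have kk: "(k, k) \<in> goe_index n" using assms(2) by (simp add: goe_index_def)
  interpret product_prob_space "\<lambda>_. std_normal_distribution" "goe_index n"
    by (intro product_prob_spaceI prob_space_std_normal)
  have D: "D \<in> sets ?G"
    unfolding D_def using kk by measurable
  then have F: "F \<in> sets ?G" by (simp add: F_def sets.Un)
  have E: "E \<in> sets (GOE n)" unfolding E_def by (rule measurable_sets[OF measurable_normalize_entries F])
  have "emeasure (GOE n) E = emeasure (distr (GOE n) ?G (normalize_entries n)) F"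
    unfolding E_def by (rule emeasure_distr[symmetric, OF measurable_normalize_entries F])
  also have "\<dots> = emeasure ?G F" by (simp only: distr_normalize_entries)
  also have "\<dots> \<le> emeasure ?G (bad_event n \<tau> (unit_vector k)) + emeasure ?G D"
    unfolding F_def using D by (intro emeasure_subadditive) auto
  also have "\<dots> \<le> ennreal (2 * exp (- (\<tau>\<^sup>2 * real n / 32))) + ennreal (sqrt 2 * exp (- (x\<^sup>2 / 8)))"
  proof (rule add_mono)
    show "emeasure ?G (bad_event n \<tau> (unit_vector k)) \<le> ennreal (2 * exp (- (\<tau>\<^sup>2 * real n / 32)))"
      by (rule emeasure_bad_event_le[OF assms(2)])
        (auto intro: half_deviation_sign_vectors_le[OF assms(1)] \<tau>)
    have "emeasure ?G D = emeasure std_normal_distribution {h. x \<le> \<bar>sqrt 2 * h\<bar>}"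
      unfolding D_def using kk by (rule emeasure_PiM_Collect_single) simp
    then show "emeasure ?G D \<le> ennreal (sqrt 2 * exp (- (x\<^sup>2 / 8)))"
      using std_normal_tail_le[of x] by (simp add: x_def)
  qed
  also have "\<dots> = ennreal (2 * exp (- (\<tau>\<^sup>2 * real n / 32)) + sqrt 2 * exp (- (x\<^sup>2 / 8)))"
    by (simp flip: ennreal_plus)
  \<comment> \<open>Both exponents are multiples of n^(1/3), with factors 1/288 and 1/32; the weaker
    one dominates and 2 + sqrt 2 \<open>\<le>\<close> 4.\<close>
  also have "\<dots> \<le> ennreal (4 * exp (- (real n powr (1/3) / 288)))"
  proof (rule ennreal_leI)
    have "(real n powr (-1/3))\<^sup>2 * real n = real n powr (-2/3) * real n powr 1"
      using n by (simp add: powr_power)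
    also have "\<dots> = real n powr (1/3)" unfolding powr_add[symmetric] by simp
    finally have t: "\<tau>\<^sup>2 * real n / 32 = real n powr (1/3) / 288" by (simp add: \<tau>_def power_divide)
    have "(real n powr (1/6))\<^sup>2 = real n powr (1/3)" using n by (simp add: powr_power)
    then have y: "x\<^sup>2 / 8 = real n powr (1/3) / 32" by (simp add: x_def power_divide)
    have "sqrt 2 * exp (- (real n powr (1/3) / 32)) \<le> 2 * exp (- (real n powr (1/3) / 288))"
      using real_sqrt_le_mono[of 2 4] by (intro mult_mono) auto
    then show "2 * exp (- (\<tau>\<^sup>2 * real n / 32)) + sqrt 2 * exp (- (x\<^sup>2 / 8)) \<le> 4 * exp (- (real n powr (1/3) / 288))"
      unfolding t y by simp
  qed
  finally have "measure (GOE n) E \<le> 4 * exp (- (real n powr (1/3) / 288))"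
    by (simp add: measure_def enn2real_leI)
  moreover have "{w \<in> space (GOE n). \<exists>lam v. spectral_decomp n (goe_mat w) lam v \<and>
       \<bar>Zmat n lam v k k\<bar> \<ge> real n powr (1/6)} \<subseteq> E"
  proof safe
    fix w lam v
    assume w: "w \<in> space (GOE n)" and sd: "spectral_decomp n (goe_mat w) lam v"
      and Z: "real n powr (1/6) \<le> \<bar>Zmat n lam v k k\<bar>"
    let ?w = "normalize_entries n w"
    have sp: "?w \<in> space ?G" using measurable_space[OF measurable_normalize_entries w] .
    have sd': "spectral_decomp n (gmat ?w) lam v"
      using sd spectral_decomp_cong[of n "gmat ?w" "goe_mat w", OF gmat_normalize_entries] by blast
    let ?d = "half_deviation n v (unit_vector k)"
    have Akk: "goe_mat w k k = sqrt 2 * ?w (k, k)"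
      using gmat_normalize_entries[OF assms(2) assms(2), of w] by (simp add: gmat_def upair_def)
    show "w \<in> E"
    proof (cases "x \<le> \<bar>sqrt 2 * ?w (k, k)\<bar>")
      case True
      then have "?w \<in> D" using sp by (simp add: D_def)
      then show ?thesis using w by (simp add: E_def F_def)
    next
      case False
      have "2 * x \<le> \<bar>3 * pi / 8 * sqrt (real n) * ?d - goe_mat w k k\<bar>"
        using Z unfolding Zmat_diagonal[OF assms(2) sd] by (simp add: x_def)
      then have "x \<le> \<bar>3 * pi / 8 * sqrt (real n) * ?d\<bar>"
        using False unfolding Akk by linarith
      also have "\<dots> = 3 * pi / 8 * \<bar>?d\<bar> * sqrt (real n)" by (simp add: abs_mult)
      finally have "x \<le> 3 * pi / 8 * \<bar>?d\<bar> * sqrt (real n)" .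
      moreover have "x = real n powr (-1/3) / 2 * sqrt (real n)"
        unfolding x_def using n by (simp add: powr_half_sqrt[symmetric] flip: powr_add)
      ultimately have "real n powr (-1/3) / 2 * sqrt (real n) \<le> 3 * pi / 8 * \<bar>?d\<bar> * sqrt (real n)" by simp
      then have "real n powr (-1/3) / 2 \<le> 3 * pi / 8 * \<bar>?d\<bar>" using n by simp
      also have "\<dots> \<le> 3 * 4 / 8 * \<bar>?d\<bar>" using pi_less_4 by (intro mult_right_mono) auto
      finally have "\<tau> \<le> \<bar>?d\<bar>" by (simp add: \<tau>_def)
      then have "?w \<in> bad_event n \<tau> (unit_vector k)"
        using sp sd' by (auto simp: bad_event_def bad_matrices_def)
      then show ?thesis using w by (simp add: E_def F_def)
    qed
  qed
  ultimately show ?thesis using E by blast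
qed

unused_thms

theorem theoremC5:
  fixes K :: real
  assumes "K > 0"
  shows "\<exists>C N. \<forall>n\<ge>N. even n \<longrightarrow> (\<forall>k<n.
           \<exists>E \<in> sets (GOE n).
             {\<omega> \<in> space (GOE n). \<exists>lam v. spectral_decomp n (goe_mat \<omega>) lam v \<and>
                 \<bar>Zmat n lam v k k\<bar> \<ge> real n powr (1/6)} \<subseteq> E \<and>
             measure (GOE n) E \<le> C * real n powr (- K))"
proof -
  \<comment> \<open>A stretched exponential is eventually below any power of n, so the constant can
    be 1 and only the threshold \<open>N\<close> depends on \<open>K\<close>.\<close>
  have "eventually (\<lambda>n. 4 * exp (- (real n powr (1/3) / 288)) \<le> 1 * real n powr (- K)) sequentially"
    using assms by real_asymp
  then obtain N where N: "\<And>n. n \<ge> N \<Longrightarrow> 4 * exp (- (real n powr (1/3) / 288)) \<le> 1 * real n powr (- K)"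
    unfolding eventually_sequentially by blast
  show ?thesis
  proof (intro exI allI impI)
    fix n k assume "n \<ge> N" "even n" "k < n"
    show "\<exists>E \<in> sets (GOE n).
             {\<omega> \<in> space (GOE n). \<exists>lam v. spectral_decomp n (goe_mat \<omega>) lam v \<and>
                 \<bar>Zmat n lam v k k\<bar> \<ge> real n powr (1/6)} \<subseteq> E \<and>
             measure (GOE n) E \<le> 1 * real n powr (- K)"
      using GOE_deviation_bound[OF \<open>even n\<close> \<open>k < n\<close>] N[OF \<open>n \<ge> N\<close>] by (meson order_trans)
  qed
qed

end
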